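(* Let $B \subseteq \omega$ be a set which is not $\Sigma^0_2$. Then for every set $A \subseteq \omega$, there is an infinite set $H$ with $H \subseteq A$ or $H \subseteq \overline{A}$ such that $B$ is not $\Sigma^{0,H}_2$ (i.e. $B$ is not $\Sigma^0_2$ relative to $H$).
   Context: $\overline{A} = \omega \setminus A$. *)

theory Defs
  imports Main
begin

datatype recf =
    Zero
  | Succ
  | Oracle
  | Proj nat
  | Comp recf "recf list"
  | PrimRec recf recf
  | Mu recf

text \<open>
  \<open>eval X p xs y\<close>: the partial recursive functional denoted by \<open>p\<close>, with (the characteristic
  function of) \<open>X\<close> as oracle, converges on the arguments \<open>xs\<close> with value \<open>y\<close>; it diverges if there is
  no such \<open>y\<close>. Programs carry no arity: \<open>Zero\<close> and \<open>Proj i\<close> accept argument lists of any (sufficient)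
  length. On inputs of a fixed length this gives the usual class of partial functions.
\<close>

inductive eval :: "nat set \<Rightarrow> recf \<Rightarrow> nat list \<Rightarrow> nat \<Rightarrow> bool" for X :: "nat set" where
  Zero: "eval X Zero xs 0"
| Succ: "eval X Succ [x] (Suc x)"
| Oracle: "eval X Oracle [x] (if x \<in> X then 1 else 0)"
| Proj: "i < length xs \<Longrightarrow> eval X (Proj i) xs (xs ! i)"
| Comp: "list_all2 (\<lambda>q y. eval X q xs y) qs ys \<Longrightarrow> eval X p ys z \<Longrightarrow> eval X (Comp p qs) xs z"
| PrimRec_0: "eval X p xs y \<Longrightarrow> eval X (PrimRec p q) (0 # xs) y"
| PrimRec_Suc: "eval X (PrimRec p q) (n # xs) y \<Longrightarrow> eval X q (n # y # xs) z
    \<Longrightarrow> eval X (PrimRec p q) (Suc n # xs) z"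
| Mu: "eval X p (n # xs) 0 \<Longrightarrow> \<forall>m<n. \<exists>v. eval X p (m # xs) (Suc v) \<Longrightarrow> eval X (Mu p) xs n"

inductive_cases eval_ZeroE: "eval X Zero xs y"
inductive_cases eval_SuccE: "eval X Succ xs y"
inductive_cases eval_OracleE: "eval X Oracle xs y"
inductive_cases eval_ProjE: "eval X (Proj i) xs y"
inductive_cases eval_CompE: "eval X (Comp p qs) xs y"
inductive_cases eval_PrimRec_0E: "eval X (PrimRec p q) (0 # xs) y"
inductive_cases eval_PrimRec_SucE: "eval X (PrimRec p q) (Suc n # xs) y"
inductive_cases eval_MuE: "eval X (Mu p) xs y"

lemma eval_deterministic: "eval X p xs y \<Longrightarrow> eval X p xs z \<Longrightarrow> y = z"
proof (induction arbitrary: z rule: eval.induct)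
  case (Zero xs)
  then show ?case by (elim eval_ZeroE) simp
next
  case (Succ x)
  then show ?case by (elim eval_SuccE) simp
next
  case (Oracle x)
  then show ?case by (elim eval_OracleE) simp_all
next
  case (Proj i xs)
  from Proj.prems show ?case by (elim eval_ProjE) simp
next
  case (Comp xs qs ys p z')
  from Comp.prems obtain ys'
    where ys': "list_all2 (\<lambda>q y. eval X q xs y) qs ys'" "eval X p ys' z"
    by (rule eval_CompE)
  have "ys = ys'"
    using Comp.IH(1) ys'(1) by (auto simp: list_all2_conv_all_nth intro!: nth_equalityI)
  with Comp.IH(2) ys'(2) show ?case by blast
next
  case (PrimRec_0 p xs y q)
  from PrimRec_0.prems PrimRec_0.IH show ?case by (elim eval_PrimRec_0E) blast
next
  case (PrimRec_Suc p q n xs y w)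
  from PrimRec_Suc.prems PrimRec_Suc.IH show ?case by (elim eval_PrimRec_SucE) blast
next
  case (Mu p n xs)
  from Mu.prems have z: "eval X p (z # xs) 0" "\<forall>m<z. \<exists>v. eval X p (m # xs) (Suc v)"
    by (auto elim: eval_MuE)
  show ?case
  proof (cases n z rule: linorder_cases)
    case less
    with z(2) Mu.IH(1) show ?thesis by blast
  next
    case greater
    with z(1) Mu.IH(2) show ?thesis by blast
  qed
qed

definition computable_rel3_in :: "nat set \<Rightarrow> (nat \<Rightarrow> nat \<Rightarrow> nat \<Rightarrow> bool) \<Rightarrow> bool" where
  "computable_rel3_in X R \<longleftrightarrow>
     (\<exists>p. \<forall>n x y. eval X p [n, x, y] (if R n x y then 1 else 0))"

definition Sigma2_in :: "nat set \<Rightarrow> nat set \<Rightarrow> bool" where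
  "Sigma2_in X B \<longleftrightarrow>
     (\<exists>R. computable_rel3_in X R \<and> B = {n. \<exists>x. \<forall>y. R n x y})"

definition Sigma2 :: "nat set \<Rightarrow> bool" where
  "Sigma2 B \<longleftrightarrow> Sigma2_in {} B"

end

theory Submission
  imports Defs "HOL-Library.Countable_Set"
begin

text \<open>
  The set \<open>H\<close> is built by a Mathias-style forcing in which \<open>\<Sigma>\<^sub>2\<close> facts about \<open>H\<close> are decided. A
  collection \<open>C\<close> of upward closed open families is large if every finite cover of the natural
  numbers has a part belonging to all families of \<open>C\<close>. A condition carries such a collection, a
  set \<open>Z\<close> that stays large under all further extensions, and an oracle \<open>E\<close> such that \<open>B\<close> is not
  \<open>\<Sigma>\<^sub>1\<close> in \<open>E\<close> and the halting problem; the set \<open>E\<close> computes \<open>Z\<close> and, with the halting problem,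
  enumerates the c.e. families incompatible with \<open>C\<close>.

  Whether \<open>n\<close> enters a given \<open>\<Sigma>\<^sub>2(H)\<close> set is asked for all covers of \<open>Z\<close> simultaneously, so that
  the answer does not depend on the arbitrary partition. By compactness the positive answers
  form a set \<open>\<Sigma>\<^sub>1\<close> in \<open>E\<close> and the halting problem, which therefore differs from \<open>B\<close>. A positive
  answer is applied to the actual partition and forces \<open>n\<close> in; a negative answer provides one
  cover, chosen by a basis theorem so that \<open>B\<close> remains complicated, and restricting \<open>Z\<close> to one
  of its parts forces \<open>n\<close> out. The sides of the partition that can be made small are discarded
  beforehand.
\<close>

section \<open>Recursive functions and relations\<close>

text \<open>The obstacle is complexity. That every later condition can still refute a witness
  \<open>x\<close> quantifies over infinite reservoirs, and a forcing question asked in this form is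
  too complex for the hypothesis on \<open>B\<close> to apply. Families remove the quantifier: the
  finite sets refuting \<open>x\<close> form a c.e. family, and demanding a refutation inside all
  later reservoirs means adding this family to the collection. Failure of largeness stays enumerable
  because a cover with k parts can be coded as one set, and compactness absorbs quantifiers over
  sets. It is not known in advance which side of the partition succeeds. All relevant sides
  therefore get a candidate in the same construction, and a requirement lists one program per side,
  asking only that some candidate defeat its own program. If every candidate failed, the programs
  responsible would form a tuple whose requirement is violated.\<close>

abbreviation push :: "'a \<Rightarrow> (nat \<Rightarrow> 'a) \<Rightarrow> nat \<Rightarrow> 'a"  (infixr "##" 65)
  where "x ## e \<equiv> case_nat x e"

text \<open>
  Functions of several arguments take an infinite environment, of which a recursive one reads
  only finitely many entries; \<open>x ## e\<close> is the environment inside the scope of a quantifier over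
  \<open>x\<close>.
\<close>

definition rec_fun :: "((nat \<Rightarrow> nat) \<Rightarrow> nat) \<Rightarrow> bool" where
  "rec_fun f \<longleftrightarrow> (\<exists>k p. \<forall>e. eval {} p (map e [0..<k]) (f e))"

lemma eval_Comp_map:
  assumes "\<And>i. i < n \<Longrightarrow> eval X (q i) xs (y i)" and "eval X p (map y [0..<n]) z"
  shows "eval X (Comp p (map q [0..<n])) xs z"
  using assms by (intro eval.Comp) (auto simp: list_all2_conv_all_nth)

text \<open>Programs depend on the shape of the argument list (\<open>Succ\<close> insists on one
  argument, \<open>PrimRec\<close> consumes the head), so programs can be combined only after being
  adapted to a common length. Projections do this.\<close>

lemma rec_fun_arity:
  assumes "rec_fun f"
  shows "\<exists>k0. \<forall>k\<ge>k0. \<exists>p. \<forall>e. eval {} p (map e [0..<k]) (f e)"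
proof -
  obtain k0 p where p: "\<And>e. eval {} p (map e [0..<k0]) (f e)"
    using assms unfolding rec_fun_def by blast
  have "eval {} (Comp p (map Proj [0..<k0])) (map e [0..<k]) (f e)" if "k \<ge> k0" for e k
    using that p eval.Proj[of _ "map e [0..<k]" "{}"] by (intro eval_Comp_map[where y = e]) auto
  then show ?thesis by blast
qed

lemma rec_fun_subst:
  assumes f: "rec_fun f" and s: "\<And>i. rec_fun (\<lambda>e. \<sigma> e i)"
  shows "rec_fun (\<lambda>e. f (\<sigma> e))"
proof -
  obtain k p where p: "\<And>e. eval {} p (map e [0..<k]) (f e)"
    using f unfolding rec_fun_def by blast
  obtain a where a: "\<And>i n. n \<ge> a i \<Longrightarrow> \<exists>q. \<forall>e. eval {} q (map e [0..<n]) (\<sigma> e i)"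
    using rec_fun_arity[OF s] by metis
  define n where "n = (\<Sum>i<k. a i)"
  have "n \<ge> a i" if "i < k" for i
    unfolding n_def using that by (intro member_le_sum) auto
  then have "\<forall>i. \<exists>q. i < k \<longrightarrow> (\<forall>e. eval {} q (map e [0..<n]) (\<sigma> e i))"
    using a by blast
  then obtain q where q: "\<And>i e. i < k \<Longrightarrow> eval {} (q i) (map e [0..<n]) (\<sigma> e i)"
    by metis
  have "eval {} (Comp p (map q [0..<k])) (map e [0..<n]) (f (\<sigma> e))" for e
    using q p by (intro eval_Comp_map[where y = "\<sigma> e"]) auto
  then show ?thesis unfolding rec_fun_def by blast
qed

lemma rec_fun_var [intro!]: "rec_fun (\<lambda>e. e i)"
  unfolding rec_fun_def
  by (intro exI[of _ "Suc i"] exI[of _ "Proj i"]) (use eval.Proj[of i "map e [0..<Suc i]"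
    for e] in \<open>simp del: upt_Suc\<close>)

lemma rec_fun_Suc [intro!]: assumes "rec_fun f" shows "rec_fun (\<lambda>e. Suc (f e))"
proof -
  have "rec_fun (\<lambda>e. Suc (e 0))"
    unfolding rec_fun_def by (intro exI[of _ 1] exI[of _ Succ]) (auto intro: eval.Succ)
  from rec_fun_subst[OF this, of "\<lambda>e _. f e"] assms show ?thesis by simp
qed

lemma rec_fun_const [intro!]: "rec_fun (\<lambda>e. c)"
proof (induction c)
  case 0
  show ?case unfolding rec_fun_def by (intro exI[of _ 0] exI[of _ Zero]) (auto intro: eval.Zero)
qed (rule rec_fun_Suc)

lemma rec_fun_push [intro!]:
  assumes "rec_fun t" "\<And>i. rec_fun (\<lambda>e. \<sigma> e i)"
  shows "rec_fun (\<lambda>e. (t e ## \<sigma> e) i)"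
  using assms by (cases i) auto

lemma map_push: "map (x ## e) [0..<Suc k] = x # map e [0..<k]"
  by (simp add: upt_conv_Cons del: upt_Suc) (simp add: map_Suc_upt[symmetric] o_def del: upt_Suc
    map_Suc_upt)

lemma rec_fun_rec_nat:
  assumes b: "rec_fun b" and f: "rec_fun f" and g: "rec_fun (\<lambda>e. g (e 0) (e 1) (\<lambda>i. e (Suc (Suc
    i))))"
  shows "rec_fun (\<lambda>e. rec_nat (f e) (\<lambda>i y. g i y e) (b e))"
proof -
  obtain k0 where k0: "\<And>k. k \<ge> k0 \<Longrightarrow> \<exists>p. \<forall>e. eval {} p (map e [0..<k]) (f e)"
    using rec_fun_arity[OF f] by blast
  obtain k1 where k1: "\<And>k. k \<ge> k1 \<Longrightarrow>
      \<exists>p. \<forall>e. eval {} p (map e [0..<k]) (g (e 0) (e 1) (\<lambda>i. e (Suc (Suc i))))"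
    using rec_fun_arity[OF g] by blast
  define k where "k = k0 + k1"
  obtain p where p: "\<And>e. eval {} p (map e [0..<k]) (f e)"
    using k0[of k] unfolding k_def by auto
  obtain q where q: "\<And>e. eval {} q (map e [0..<Suc (Suc k)]) (g (e 0) (e 1) (\<lambda>i. e (Suc (Suc i))))"
    using k1[of "Suc (Suc k)"] unfolding k_def by auto
  have q': "eval {} q (n # y # map e [0..<k]) (g n y e)" for n y e
    using q[of "n ## y ## e"] unfolding map_push by simp
  have "eval {} (PrimRec p q) (n # map e [0..<k]) (rec_nat (f e) (\<lambda>i y. g i y e) n)" for n e
    by (induction n) (auto intro: eval.PrimRec_0 eval.PrimRec_Suc p q')
  then have "eval {} (PrimRec p q) (map (n ## e) [0..<Suc k])
      (rec_nat (f e) (\<lambda>i y. g i y e) n)" for n e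
    by (simp only: map_push)
  from this[of "e 0" "\<lambda>i. e (Suc i)" for e]
  have "eval {} (PrimRec p q) (map e [0..<Suc k])
      (rec_nat (f (\<lambda>i. e (Suc i))) (\<lambda>i y. g i y (\<lambda>i. e (Suc i))) (e 0))" for e
    unfolding map_push by (simp add: upt_conv_Cons map_Suc_upt[symmetric] o_def del: upt_Suc
      map_Suc_upt)
  then have "rec_fun (\<lambda>e. rec_nat (f (\<lambda>i. e (Suc i))) (\<lambda>i y. g i y (\<lambda>i. e (Suc i))) (e 0))"
    unfolding rec_fun_def by blast
  from rec_fun_subst[OF this, of "\<lambda>e. b e ## e"] b show ?thesis
    by (simp add: rec_fun_push rec_fun_var)
qed

lemma rec_fun_Least:
  assumes f: "rec_fun (\<lambda>e. f (e 0) (\<lambda>i. e (Suc i)))" and ex: "\<And>e. \<exists>n. f n e = 0"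
  shows "rec_fun (\<lambda>e. LEAST n. f n e = 0)"
proof -
  obtain k0 where "\<And>k. k \<ge> k0 \<Longrightarrow> \<exists>p. \<forall>e. eval {} p (map e [0..<k]) (f (e 0) (\<lambda>i. e (Suc i)))"
    using rec_fun_arity[OF f] by blast
  from this[of "Suc k0"] obtain p where
    p: "\<And>e. eval {} p (map e [0..<Suc k0]) (f (e 0) (\<lambda>i. e (Suc i)))" by auto
  have p': "eval {} p (n # map e [0..<k0]) (f n e)" for n e
    using p[of "n ## e"] unfolding map_push by simp
  have "eval {} (Mu p) (map e [0..<k0]) (LEAST n. f n e = 0)" for e
  proof (rule eval.Mu)
    show "eval {} p ((LEAST n. f n e = 0) # map e [0..<k0]) 0"
      using p'[of "LEAST n. f n e = 0" e] LeastI_ex[OF ex[of e]] by simp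
    show "\<forall>m<(LEAST n. f n e = 0). \<exists>v. eval {} p (m # map e [0..<k0]) (Suc v)"
    proof (intro allI impI)
      fix m assume "m < (LEAST n. f n e = 0)"
      then have "f m e \<noteq> 0" by (rule not_less_Least)
      then show "\<exists>v. eval {} p (m # map e [0..<k0]) (Suc v)"
        using p'[of m e] by (cases "f m e") auto
    qed
  qed
  then show ?thesis unfolding rec_fun_def by blast
qed

lemma rec_fun_add [intro!]: assumes "rec_fun f" "rec_fun g" shows "rec_fun (\<lambda>e. f e + g e)"
proof -
  have "rec_nat y (\<lambda>i z. Suc z) x = x + y" for x y :: nat
    by (induction x) auto
  then show ?thesis
    using rec_fun_rec_nat[OF assms, of "\<lambda>i y e. Suc y"] rec_fun_Suc[OF rec_fun_var[of 1]] by simp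
qed

lemma rec_fun_mult [intro!]: assumes "rec_fun f" "rec_fun g" shows "rec_fun (\<lambda>e. f e * g e)"
proof -
  have "rec_nat 0 (\<lambda>i z. z + y) x = x * y" for x y :: nat
    by (induction x) auto
  moreover have "rec_fun (\<lambda>e. e (Suc 0) + g (\<lambda>i. e (Suc (Suc i))))"
    by (intro rec_fun_add rec_fun_var rec_fun_subst[OF assms(2)])
  ultimately show ?thesis
    using rec_fun_rec_nat[OF assms(1) rec_fun_const, of "\<lambda>i y e. y + g e" 0] by simp
qed

lemma rec_fun_power [intro!]: assumes "rec_fun f" "rec_fun g" shows "rec_fun (\<lambda>e. f e ^ g e)"
proof -
  have "rec_nat 1 (\<lambda>i z. z * y) x = y ^ x" for x y :: nat
    by (induction x) auto
  moreover have "rec_fun (\<lambda>e. e (Suc 0) * f (\<lambda>i. e (Suc (Suc i))))"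
    by (intro rec_fun_mult rec_fun_var rec_fun_subst[OF assms(1)])
  ultimately show ?thesis
    using rec_fun_rec_nat[OF assms(2) rec_fun_const, of "\<lambda>i y e. y * f e" 1] by simp
qed

lemma rec_fun_diff [intro!]: assumes "rec_fun f" "rec_fun g" shows "rec_fun (\<lambda>e. f e - g e)"
proof -
  have "rec_nat 0 (\<lambda>i z. i) x = x - 1" for x :: nat
    by (cases x) auto
  then have pred: "rec_fun (\<lambda>e. e i - 1)" for i
    using rec_fun_rec_nat[OF rec_fun_var[of i] rec_fun_const[of 0], of "\<lambda>i y e. i"]
      by (simp add: rec_fun_var)
  have "rec_nat x (\<lambda>i z. z - 1) y = x - y" for x y :: nat
    by (induction y) auto
  with pred show ?thesis
    using rec_fun_rec_nat[OF assms(2,1), of "\<lambda>i y e. y - 1"] by simp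
qed

section \<open>Decidable relations and bounded quantifiers\<close>

definition rec_rel :: "((nat \<Rightarrow> nat) \<Rightarrow> bool) \<Rightarrow> bool" where
  "rec_rel P \<longleftrightarrow> rec_fun (\<lambda>e. if P e then 1 else 0)"

lemma rec_rel_subst: "rec_rel P \<Longrightarrow> (\<And>i. rec_fun (\<lambda>e. \<sigma> e i)) \<Longrightarrow> rec_rel (\<lambda>e. P (\<sigma> e))"
  unfolding rec_rel_def by (rule rec_fun_subst)

lemma rec_rel_not [intro!]: assumes "rec_rel P" shows "rec_rel (\<lambda>e. \<not> P e)"
proof -
  have "(\<lambda>e. if \<not> P e then 1 else 0) = (\<lambda>e. 1 - (if P e then 1 else 0 :: nat))" by auto
  then show ?thesis
    using rec_fun_diff[OF rec_fun_const[of 1] assms[unfolded rec_rel_def]]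
      by (simp only: rec_rel_def)
qed

lemma rec_rel_conj [intro!]: assumes "rec_rel P" "rec_rel Q" shows "rec_rel (\<lambda>e. P e \<and> Q e)"
proof -
  have "(\<lambda>e. if P e \<and> Q e then 1 else 0) =
      (\<lambda>e. (if P e then 1 else 0) * (if Q e then 1 else 0 :: nat))" by auto
  then show ?thesis using rec_fun_mult[OF assms[unfolded rec_rel_def]] by (simp only: rec_rel_def)
qed

lemma rec_rel_disj [intro!]: assumes "rec_rel P" "rec_rel Q" shows "rec_rel (\<lambda>e. P e \<or> Q e)"
  using rec_rel_not[OF rec_rel_conj[OF rec_rel_not rec_rel_not, OF assms]] by simp

lemma rec_rel_imp [intro!]: assumes "rec_rel P" "rec_rel Q" shows "rec_rel (\<lambda>e. P e \<longrightarrow> Q e)"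
  using rec_rel_disj[OF rec_rel_not assms(2), OF assms(1)] by (simp only: imp_conv_disj)

lemma rec_rel_iff [intro!]: assumes "rec_rel P" "rec_rel Q" shows "rec_rel (\<lambda>e. P e \<longleftrightarrow> Q e)"
  using rec_rel_conj[OF rec_rel_imp rec_rel_imp, OF assms assms(2,1)]
    by (simp only: iff_conv_conj_imp)

lemma rec_rel_const [intro!]: "rec_rel (\<lambda>e. b)"
  unfolding rec_rel_def by (cases b) auto

lemma rec_rel_le [intro!]: assumes "rec_fun f" "rec_fun g" shows "rec_rel (\<lambda>e. f e \<le> g e)"
proof -
  have "(\<lambda>e. if f e \<le> g e then 1 else 0) = (\<lambda>e. 1 - (f e - g e))" by auto
  then show ?thesis
    using rec_fun_diff[OF rec_fun_const[of 1] rec_fun_diff[OF assms]] by (simp only: rec_rel_def)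
qed

lemma rec_rel_less [intro!]: assumes "rec_fun f" "rec_fun g" shows "rec_rel (\<lambda>e. f e < g e)"
  using rec_rel_le[OF rec_fun_Suc, OF assms] by (simp add: Suc_le_eq)

lemma rec_rel_eq [intro!]: assumes "rec_fun f" "rec_fun g" shows "rec_rel (\<lambda>e. f e = g e)"
  using rec_rel_conj[OF rec_rel_le rec_rel_le, OF assms assms(2,1)] by (simp add: eq_iff)

lemma rec_fun_Least_rec_rel:
  assumes "rec_rel (\<lambda>e. P (e 0) (\<lambda>i. e (Suc i)))" and "\<And>e. \<exists>n. P n e"
  shows "rec_fun (\<lambda>e. LEAST n. P n e)"
proof -
  have "rec_fun (\<lambda>e. (if \<not> P (e 0) (\<lambda>i. e (Suc i)) then 1 else 0))"
    using rec_rel_not[OF assms(1)] unfolding rec_rel_def .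
  from rec_fun_Least[where f = "\<lambda>n e. if \<not> P n e then 1 else 0", OF this]
  have "rec_fun (\<lambda>e. LEAST n. (if \<not> P n e then 1 else 0 :: nat) = 0)"
    using assms(2) by (metis (no_types, lifting))
  moreover have "(if \<not> P n e then 1 else 0 :: nat) = 0 \<longleftrightarrow> P n e" for n e by simp
  ultimately show ?thesis by (simp only:)
qed

text \<open>The bound itself stops the search, so the least number that reaches the bound or is a
  counterexample always exists; comparing it with the bound decides the quantifier.\<close>

lemma rec_rel_ball:
  assumes P: "rec_rel (\<lambda>e. P (e 0) (\<lambda>i. e (Suc i)))" and b: "rec_fun b"
  shows "rec_rel (\<lambda>e. \<forall>i<b e. P i e)"
proof -
  have "rec_fun (\<lambda>e. LEAST n. n \<ge> b e \<or> \<not> P n e)"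
    by (rule rec_fun_Least_rec_rel) (auto intro!: P rec_fun_subst[OF b])
  then have "rec_rel (\<lambda>e. b e \<le> (LEAST n. n \<ge> b e \<or> \<not> P n e))" using b by auto
  moreover have "b e \<le> (LEAST n. n \<ge> b e \<or> \<not> P n e) \<longleftrightarrow> (\<forall>i<b e. P i e)" for e
  proof
    assume *: "b e \<le> (LEAST n. n \<ge> b e \<or> \<not> P n e)"
    show "\<forall>i<b e. P i e"
    proof (intro allI impI)
      fix i assume "i < b e"
      with * have "i < (LEAST n. n \<ge> b e \<or> \<not> P n e)" by simp
      from not_less_Least[OF this] show "P i e" by simp
    qed
  next
    assume *: "\<forall>i<b e. P i e"
    have "(LEAST n. n \<ge> b e \<or> \<not> P n e) \<ge> b e \<or> \<not> P (LEAST n. n \<ge> b e \<or> \<not> P n e) e"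
      by (rule LeastI[of "\<lambda>n. n \<ge> b e \<or> \<not> P n e" "b e"]) simp
    with * show "b e \<le> (LEAST n. n \<ge> b e \<or> \<not> P n e)" by (meson not_le)
  qed
  ultimately show ?thesis by simp
qed

lemma rec_rel_bex:
  assumes "rec_rel (\<lambda>e. P (e 0) (\<lambda>i. e (Suc i)))" and "rec_fun b"
  shows "rec_rel (\<lambda>e. \<exists>i<b e. P i e)"
  using rec_rel_not[OF rec_rel_ball[OF rec_rel_not assms(2), OF assms(1)]] by simp

lemma rec_fun_div [intro!]: assumes "rec_fun f" "rec_fun g" shows "rec_fun (\<lambda>e. f e div g e)"
proof -
  \<comment> \<open>The first disjunct keeps the search total and makes it return 0, the value of
    division by zero.\<close>
  have "rec_fun (\<lambda>e. LEAST q. g e = 0 \<or> f e < Suc q * g e)"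
  proof (rule rec_fun_Least_rec_rel)
    show "\<exists>n. g e = 0 \<or> f e < Suc n * g e" for e
      by (rule exI[of _ "f e"]) (cases "g e", auto)
  qed (auto intro!: assms[THEN rec_fun_subst])
  moreover have "(LEAST q. m = 0 \<or> n < Suc q * m) = n div m" for m n :: nat
  proof (rule Least_equality)
    show "m = 0 \<or> n < Suc (n div m) * m"
      using dividend_less_div_times[of m n] by auto
    show "n div m \<le> q" if "m = 0 \<or> n < Suc q * m" for q
    proof (cases "m = 0")
      case False
      then show ?thesis using that less_mult_imp_div_less[of n "Suc q" m] by linarith
    qed simp
  qed
  ultimately show ?thesis by simp
qed

lemma rec_fun_mod [intro!]: assumes "rec_fun f" "rec_fun g" shows "rec_fun (\<lambda>e. f e mod g e)"
  using rec_fun_diff[OF assms(1) rec_fun_mult[OF assms(2) rec_fun_div[OF assms]]]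
    by (simp add: minus_mult_div_eq_mod)

lemma rec_rel_decode [intro!]: assumes "rec_fun f" "rec_fun g"
  shows "rec_rel (\<lambda>e. f e \<in> set_decode (g e))"
proof -
  have "rec_rel (\<lambda>e. (g e div 2 ^ f e) mod 2 = 1)" using assms by auto
  then show ?thesis by (simp add: set_decode_def odd_iff_mod_2_eq_one)
qed

section \<open>Arithmetical classes\<close>

text \<open>The common closure properties of the recursive, \<open>\<Sigma>\<^sub>1\<close>,
  \<open>\<Pi>\<^sub>1\<close> and \<open>\<Sigma>\<^sub>2\<close> relations. Each level is lifted
  to the next from these alone, and open predicates are treated once for all levels.\<close>

locale bounded_class =
  fixes K :: "((nat \<Rightarrow> nat) \<Rightarrow> bool) \<Rightarrow> bool"
  assumes rec_rel: "rec_rel P \<Longrightarrow> K P"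
    and subst: "K P \<Longrightarrow> (\<And>i. rec_fun (\<lambda>e. \<sigma> e i)) \<Longrightarrow> K (\<lambda>e. P (\<sigma> e))"
    and conj: "K P \<Longrightarrow> K Q \<Longrightarrow> K (\<lambda>e. P e \<and> Q e)"
    and disj: "K P \<Longrightarrow> K Q \<Longrightarrow> K (\<lambda>e. P e \<or> Q e)"
    and ball: "K (\<lambda>e. R (e 0) (\<lambda>i. e (Suc i))) \<Longrightarrow> rec_fun b \<Longrightarrow> K (\<lambda>e. \<forall>x<b e. R x e)"
    and bex: "K (\<lambda>e. R (e 0) (\<lambda>i. e (Suc i))) \<Longrightarrow> rec_fun b \<Longrightarrow> K (\<lambda>e. \<exists>x<b e. R x e)"

locale sigma_class = bounded_class +
  assumes ex: "K (\<lambda>e. R (e 0) (\<lambda>i. e (Suc i))) \<Longrightarrow> K (\<lambda>e. \<exists>x. R x e)"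

definition proj :: "(((nat \<Rightarrow> nat) \<Rightarrow> bool) \<Rightarrow> bool) \<Rightarrow> ((nat \<Rightarrow> nat) \<Rightarrow> bool) \<Rightarrow> bool" where
  "proj K P \<longleftrightarrow> (\<exists>R. K R \<and> (\<forall>e. P e \<longleftrightarrow> (\<exists>z. R (z ## e))))"

lemma projI:
  assumes "K (\<lambda>e. R (e 0) (\<lambda>i. e (Suc i)))" "\<And>e. P e \<longleftrightarrow> (\<exists>z. R z e)"
  shows "proj K P"
  unfolding proj_def using assms by (intro exI[of _ "\<lambda>e. R (e 0) (\<lambda>i. e (Suc i))"]) simp

lemma (in bounded_class) projE:
  assumes "proj K P"
  obtains R where "\<And>t \<sigma>. rec_fun t \<Longrightarrow> (\<And>i. rec_fun (\<lambda>e. \<sigma> e i)) \<Longrightarrow> K (\<lambda>e. R (t e) (\<sigma> e))"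
    and "\<And>e. P e \<longleftrightarrow> (\<exists>z. R z e)"
proof -
  obtain Q where Q: "K Q" "\<And>e. P e \<longleftrightarrow> (\<exists>z. Q (z ## e))"
    using assms unfolding proj_def by blast
  show ?thesis
    by (rule that[of "\<lambda>z e. Q (z ## e)"]) (auto intro: subst[OF Q(1)] rec_fun_push simp: Q(2))
qed

lemma finite_collection:
  assumes "\<forall>x<(b::nat). \<exists>z. Q x z"
  shows "\<exists>w::nat. \<forall>x<b. \<exists>z<w. Q x z"
proof -
  obtain f where f: "\<And>x. x < b \<Longrightarrow> Q x (f x)" using assms by metis
  have "f x < Suc (\<Sum>x<b. f x)" if "x < b" for x
    using that by (simp add: less_Suc_eq_le member_le_sum)
  with f show ?thesis by blast
qed

text \<open>Several existential witnesses are merged into a common bound \<open>w\<close> instead of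
  a coded tuple, which leaves only bounded quantifiers in the matrix. A bounded universal quantifier
  is pulled inside by \<open>finite_collection\<close>.\<close>

lemma (in bounded_class) sigma_class_proj: "sigma_class (proj K)"
proof
  fix P Q :: "(nat \<Rightarrow> nat) \<Rightarrow> bool" and R :: "nat \<Rightarrow> (nat \<Rightarrow> nat) \<Rightarrow> bool" and \<sigma> b
  show "proj K P" if "rec_rel P"
    using subst[OF rec_rel[OF that], of "\<lambda>e i. e (Suc i)"]
    by (intro projI[of _ "\<lambda>z e. P e"]) (auto intro: rec_fun_var)
  show "proj K (\<lambda>e. P (\<sigma> e))" if P: "proj K P" and s: "\<And>i. rec_fun (\<lambda>e. \<sigma> e i)"
  proof -
    obtain T where T: "\<And>t \<sigma>. rec_fun t \<Longrightarrow> (\<And>i. rec_fun (\<lambda>e. \<sigma> e i)) \<Longrightarrow> K (\<lambda>e. T (t e) (\<sigma> e))"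
      "\<And>e. P e \<longleftrightarrow> (\<exists>z. T z e)" using projE[OF P] by blast
    show ?thesis
      by (rule projI[of _ "\<lambda>z e. T z (\<sigma> e)"])
        (auto intro!: T(1) rec_fun_var rec_fun_subst[OF s] simp: T(2))
  qed
  show "proj K (\<lambda>e. P e \<and> Q e)" "proj K (\<lambda>e. P e \<or> Q e)" if P: "proj K P" and Q: "proj K Q"
  proof -
    obtain T where T: "\<And>t \<sigma>. rec_fun t \<Longrightarrow> (\<And>i. rec_fun (\<lambda>e. \<sigma> e i)) \<Longrightarrow> K (\<lambda>e. T (t e) (\<sigma> e))"
      "\<And>e. P e \<longleftrightarrow> (\<exists>z. T z e)" using projE[OF P] by blast
    obtain U where U: "\<And>t \<sigma>. rec_fun t \<Longrightarrow> (\<And>i. rec_fun (\<lambda>e. \<sigma> e i)) \<Longrightarrow> K (\<lambda>e. U (t e) (\<sigma> e))"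
      "\<And>e. Q e \<longleftrightarrow> (\<exists>z. U z e)" using projE[OF Q] by blast
    show "proj K (\<lambda>e. P e \<and> Q e)"
    proof (rule projI[of _ "\<lambda>w e. (\<exists>z<w. T z e) \<and> (\<exists>z<w. U z e)"])
      show "P e \<and> Q e \<longleftrightarrow> (\<exists>w. (\<exists>z<w. T z e) \<and> (\<exists>z<w. U z e))" for e
        unfolding T U by (metis less_Suc_eq_le max.cobounded1 max.cobounded2)
    qed (intro conj bex T U rec_fun_var)
    show "proj K (\<lambda>e. P e \<or> Q e)"
      by (rule projI[of _ "\<lambda>w e. T w e \<or> U w e"])
        (auto intro!: disj T(1) U(1) rec_fun_var simp: T(2) U(2))
  qed
  show "proj K (\<lambda>e. \<exists>x. R x e)" "rec_fun b \<Longrightarrow> proj K (\<lambda>e. \<forall>x<b e. R x e)"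
    "rec_fun b \<Longrightarrow> proj K (\<lambda>e. \<exists>x<b e. R x e)"
    if R: "proj K (\<lambda>e. R (e 0) (\<lambda>i. e (Suc i)))"
  proof -
    obtain T where T: "\<And>t \<sigma>. rec_fun t \<Longrightarrow> (\<And>i. rec_fun (\<lambda>e. \<sigma> e i)) \<Longrightarrow> K (\<lambda>e. T (t e) (\<sigma> e))"
      and "\<And>e. R (e 0) (\<lambda>i. e (Suc i)) \<longleftrightarrow> (\<exists>z. T z e)" using projE[OF R] by blast
    from this(2)[of "x ## e" for x e] have R: "R x e \<longleftrightarrow> (\<exists>z. T z (x ## e))" for x e by simp
    show "proj K (\<lambda>e. \<exists>x. R x e)"
    proof (rule projI[of _ "\<lambda>w e. \<exists>x<w. \<exists>z<w. T z (x ## e)"])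
      show "(\<exists>x. R x e) \<longleftrightarrow> (\<exists>w. \<exists>x<w. \<exists>z<w. T z (x ## e))" for e
        unfolding R by (metis less_Suc_eq_le max.cobounded1 max.cobounded2)
    qed (intro bex T rec_fun_var rec_fun_push)
    assume b: "rec_fun b"
    show "proj K (\<lambda>e. \<forall>x<b e. R x e)"
    proof (rule projI[of _ "\<lambda>w e. \<forall>x<b e. \<exists>z<w. T z (x ## e)"])
      show "(\<forall>x<b e. R x e) \<longleftrightarrow> (\<exists>w. \<forall>x<b e. \<exists>z<w. T z (x ## e))" for e
        unfolding R using finite_collection[of "b e" "\<lambda>x z. T z (x ## e)"] by blast
    qed (intro ball bex T rec_fun_var rec_fun_push rec_fun_subst[OF b])
    show "proj K (\<lambda>e. \<exists>x<b e. R x e)"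
      by (rule projI[of _ "\<lambda>w e. \<exists>x<b e. T w (x ## e)"])
        (auto intro!: bex T rec_fun_var rec_fun_push rec_fun_subst[OF b] simp: R)
  qed
qed

section \<open>The first two levels of the arithmetical hierarchy\<close>

interpretation rec_rel: bounded_class rec_rel
  by unfold_locales (auto intro: rec_rel_subst rec_rel_ball rec_rel_bex)

definition sig1 :: "((nat \<Rightarrow> nat) \<Rightarrow> bool) \<Rightarrow> bool" where "sig1 = proj rec_rel"

interpretation sig1: sigma_class sig1
  unfolding sig1_def by (rule rec_rel.sigma_class_proj)

interpretation pi1: bounded_class "\<lambda>P. sig1 (\<lambda>e. \<not> P e)"
proof
  fix P Q :: "(nat \<Rightarrow> nat) \<Rightarrow> bool" and R :: "nat \<Rightarrow> (nat \<Rightarrow> nat) \<Rightarrow> bool" and b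
  show "sig1 (\<lambda>e. \<not> (\<forall>x<b e. R x e))" if "sig1 (\<lambda>e. \<not> R (e 0) (\<lambda>i. e (Suc i)))" "rec_fun b"
    using sig1.bex[of "\<lambda>x e. \<not> R x e", OF that] by simp
  show "sig1 (\<lambda>e. \<not> (\<exists>x<b e. R x e))" if "sig1 (\<lambda>e. \<not> R (e 0) (\<lambda>i. e (Suc i)))" "rec_fun b"
    using sig1.ball[of "\<lambda>x e. \<not> R x e", OF that] by simp
  show "sig1 (\<lambda>e. \<not> P e)" if "rec_rel P"
    using that by (intro sig1.rec_rel rec_rel_not)
  show "sig1 (\<lambda>e. \<not> P (\<sigma> e))" if "sig1 (\<lambda>e. \<not> P e)" "\<And>i. rec_fun (\<lambda>e. \<sigma> e i)" for \<sigma>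
    using sig1.subst[OF that] .
qed (auto simp only: de_Morgan_conj de_Morgan_disj intro: sig1.conj sig1.disj)

definition sig2 :: "((nat \<Rightarrow> nat) \<Rightarrow> bool) \<Rightarrow> bool" where
  "sig2 = proj (\<lambda>P. sig1 (\<lambda>e. \<not> P e))"

interpretation sig2: sigma_class sig2
  unfolding sig2_def by (rule pi1.sigma_class_proj)

lemma sig2_not_sig1: assumes "sig1 P" shows "sig2 (\<lambda>e. \<not> P e)"
  unfolding sig2_def
  by (rule projI[of _ "\<lambda>z e. \<not> P e"]) (auto intro: sig1.subst[OF assms] rec_fun_var)

lemma sig1_imp_sig2: assumes "sig1 P" shows "sig2 P"
proof -
  obtain R where R: "rec_rel R" "\<And>e. P e \<longleftrightarrow> (\<exists>z. R (z ## e))"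
    using assms unfolding sig1_def proj_def by blast
  have "sig2 (\<lambda>e. \<exists>z. R (z ## e))"
    by (intro sig2.ex sig2.rec_rel rec_rel_subst[OF R(1)] rec_fun_push rec_fun_var)
  then show ?thesis unfolding R(2)[abs_def, symmetric] by (simp add: R(2))
qed

lemma sig2_iff_rec_rel:
  "sig2 P \<longleftrightarrow> (\<exists>R. rec_rel R \<and> (\<forall>e. P e \<longleftrightarrow> (\<exists>x. \<forall>y. R (y ## x ## e))))" (is "_ \<longleftrightarrow> ?rhs")
proof
  assume "sig2 P"
  then obtain Q where Q: "sig1 (\<lambda>e. \<not> Q e)" "\<And>e. P e \<longleftrightarrow> (\<exists>x. Q (x ## e))"
    unfolding sig2_def proj_def by blast
  then obtain R where "rec_rel R" "\<And>e. \<not> Q e \<longleftrightarrow> (\<exists>z. R (z ## e))"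
    unfolding sig1_def proj_def by blast
  with Q(2) show ?rhs by (intro exI[of _ "\<lambda>e. \<not> R e"]) (metis rec_rel_not)
next
  assume ?rhs
  then obtain R where R: "rec_rel R" "\<And>e. P e \<longleftrightarrow> (\<exists>x. \<forall>y. R (y ## x ## e))" by blast
  have "sig2 (\<lambda>e. \<exists>x. \<not> (\<exists>y. \<not> R (y ## x ## e)))"
    by (intro sig2.ex sig2_not_sig1 sig1.ex sig1.rec_rel rec_rel_not rec_rel_subst[OF R(1)]
      rec_fun_push rec_fun_var)
  moreover have "P = (\<lambda>e. \<exists>x. \<not> (\<exists>y. \<not> R (y ## x ## e)))" by (rule ext) (simp add: R(2))
  ultimately show "sig2 P" by simp
qed

text \<open>Returns from environments to programs with exactly three arguments. The environment
  \<open>c\<close> is infinite, but only finitely many of its entries are read, and these are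
  supplied as constants.\<close>

lemma Sigma2_if_sig2:
  assumes "sig2 P"
  shows "Sigma2 {n. P (n ## c)}"
proof -
  obtain R where R: "rec_rel R" "\<And>e. P e \<longleftrightarrow> (\<exists>x. \<forall>y. R (y ## x ## e))"
    using assms unfolding sig2_iff_rec_rel by blast
  obtain p k where p: "\<And>e. eval {} p (map e [0..<k]) (if R e then 1 else 0)"
    using R(1) unfolding rec_rel_def rec_fun_def by blast
  have "rec_fun (\<lambda>e. (e 2 ## e 1 ## e 0 ## c) i)" for i
    by (intro rec_fun_push rec_fun_var rec_fun_const)
  then have "rec_rel (\<lambda>e. R (e 2 ## e 1 ## e 0 ## c))"
    by (intro rec_rel_subst[OF R(1)])
  then obtain k p where p: "\<And>e. eval {} p (map e [0..<k]) (if R (e 2 ## e 1 ## e 0 ## c) then 1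
    else 0)"
    unfolding rec_rel_def rec_fun_def by blast
  define q where "q i = (if i < 3 then Proj i else Zero)" for i
  have "eval {} (Comp p (map q [0..<k])) [n, x, y] (if R (y ## x ## n ## c) then 1 else 0)"
    for n x y
  proof (rule eval_Comp_map)
    let ?e = "n ## x ## y ## (\<lambda>_. 0)"
    show "eval {} (q i) [n, x, y] (?e i)" for i
    proof (cases "i < 3")
      case True
      then have "?e i = [n, x, y] ! i" by (auto simp: less_Suc_eq numeral_3_eq_3)
      with True eval.Proj[of i "[n, x, y]"] show ?thesis by (simp add: q_def)
    next
      case False
      then obtain j where "i = Suc (Suc (Suc j))"
        by (metis One_nat_def Suc_1 less_Suc0 not_less_eq numeral_3_eq_3 not0_implies_Suc
          zero_less_Suc)
      with False show ?thesis by (auto simp: q_def intro: eval.Zero)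
    qed
    show "eval {} p (map ?e [0..<k]) (if R (y ## x ## n ## c) then 1 else 0)"
      using p[of ?e] by (simp add: numeral_2_eq_2)
  qed
  then have "computable_rel3_in {} (\<lambda>n x y. R (y ## x ## n ## c))"
    unfolding computable_rel3_in_def by blast
  then show ?thesis
    unfolding Sigma2_def Sigma2_in_def by (intro exI[of _ "\<lambda>n x y. R (y ## x ## n ## c)"])
      (simp add: R(2))
qed

text \<open>Makes finitely many unrelated relations uniform in their index, by a finite case
  distinction.\<close>

lemma finite_case_sig1:
  assumes "\<And>j. j < k \<Longrightarrow> sig1 (P j)"
  shows "\<exists>Q. sig1 Q \<and> (\<forall>j<k. \<forall>e. Q (j ## e) \<longleftrightarrow> P j e)"
proof -
  have "\<exists>Q. sig1 Q \<and> (\<forall>j e. Q (j ## e) \<longleftrightarrow> j < k \<and> P j e)"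
    using assms
  proof (induction k)
    case 0
    show ?case by (intro exI[of _ "\<lambda>e. False"]) (auto intro: sig1.rec_rel rec_rel_const)
  next
    case (Suc k)
    then obtain Q where Q: "sig1 Q" "\<And>j e. Q (j ## e) \<longleftrightarrow> j < k \<and> P j e" by auto
    have "sig1 (\<lambda>e. Q e \<or> (e 0 = k \<and> P k (\<lambda>i. e (Suc i))))"
      by (intro sig1.disj sig1.conj Q(1) sig1.rec_rel rec_rel_eq rec_fun_var rec_fun_const
        sig1.subst[OF Suc.prems[of k]]) simp
    then show ?case
      by (intro exI[of _ "\<lambda>e. Q e \<or> (e 0 = k \<and> P k (\<lambda>i. e (Suc i)))"]) (auto simp: Q(2) less_Suc_eq)
  qed
  then show ?thesis by blast
qed

section \<open>Computations with an oracle\<close>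

definition agree :: "nat \<Rightarrow> nat set \<Rightarrow> nat set \<Rightarrow> bool" where
  "agree m X Y \<longleftrightarrow> (\<forall>i<m. i \<in> X \<longleftrightarrow> i \<in> Y)"

lemma agree_mono: "agree n X Y \<Longrightarrow> m \<le> n \<Longrightarrow> agree m X Y"
  by (simp add: agree_def)

text \<open>The use principle: a halting computation puts only finitely many questions to its
  oracle.\<close>

lemma eval_use:
  assumes "eval H p xs y"
  shows "\<exists>m. \<forall>H'. agree m H H' \<longrightarrow> eval H' p xs y"
  using assms
proof (induction rule: eval.induct)
  case (Oracle x)
  have "eval H' Oracle [x] (if x \<in> H then 1 else 0)" if "agree (Suc x) H H'" for H'
    using eval.Oracle[of H' x] that by (simp add: agree_def)
  then show ?case by blast
next
  case (Comp xs qs ys p z)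
  then have "\<forall>i. \<exists>m. i < length qs \<longrightarrow> (\<forall>H'. agree m H H' \<longrightarrow> eval H' (qs ! i) xs (ys ! i))"
    by (auto simp: list_all2_conv_all_nth)
  then obtain m where m: "\<And>i H'. i < length qs \<Longrightarrow> agree (m i) H H' \<Longrightarrow> eval H' (qs ! i) xs (ys ! i)"
    by metis
  obtain n where n: "\<And>H'. agree n H H' \<Longrightarrow> eval H' p ys z"
    using Comp by blast
  have "eval H' (Comp p qs) xs z" if a: "agree (n + (\<Sum>i<length qs. m i)) H H'" for H'
  proof (rule eval.Comp)
    have "m i \<le> (\<Sum>i<length qs. m i)" if "i < length qs" for i
      using that by (intro member_le_sum) auto
    then have "agree (m i) H H'" if "i < length qs" for i
      using agree_mono[OF a trans_le_add2] that by blast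
    then show "list_all2 (\<lambda>q y. eval H' q xs y) qs ys"
      using m list_all2_lengthD[OF Comp.IH(1)] by (simp add: list_all2_conv_all_nth)
    show "eval H' p ys z" using n agree_mono[OF a] by simp
  qed
  then show ?case by blast
next
  case (PrimRec_Suc p q n xs y z)
  then obtain m m' where "\<And>H'. agree m H H' \<Longrightarrow> eval H' (PrimRec p q) (n # xs) y"
    "\<And>H'. agree m' H H' \<Longrightarrow> eval H' q (n # y # xs) z" by blast
  then have "eval H' (PrimRec p q) (Suc n # xs) z" if "agree (m + m') H H'" for H'
    using agree_mono[OF that] by (intro eval.PrimRec_Suc[of _ _ _ _ _ y]) auto
  then show ?case by blast
next
  case (Mu p n xs)
  then obtain m0 where m0: "\<And>H'. agree m0 H H' \<Longrightarrow> eval H' p (n # xs) 0" by blast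
  have "\<forall>i. \<exists>v m. i < n \<longrightarrow> (\<forall>H'. agree m H H' \<longrightarrow> eval H' p (i # xs) (Suc v))"
    using Mu by blast
  then obtain v m where m: "\<And>i H'. i < n \<Longrightarrow> agree (m i) H H' \<Longrightarrow> eval H' p (i # xs) (Suc (v i))"
    by metis
  have "eval H' (Mu p) xs n" if a: "agree (m0 + (\<Sum>i<n. m i)) H H'" for H'
  proof (rule eval.Mu)
    show "eval H' p (n # xs) 0" using agree_mono[OF a] m0 by simp
    have "m i \<le> (\<Sum>i<n. m i)" if "i < n" for i
      using that by (intro member_le_sum) auto
    then have "agree (m i) H H'" if "i < n" for i
      using agree_mono[OF a trans_le_add2] that by blast
    with m show "\<forall>i<n. \<exists>v. eval H' p (i # xs) (Suc v)" by blast
  qed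
  then show ?case by blast
qed (blast intro: eval.intros)+

text \<open>Codes finite sequences. The base belongs to the code, so entries of any size
  fit.\<close>

definition digit :: "nat \<Rightarrow> nat \<Rightarrow> nat \<Rightarrow> nat" where
  "digit c b i = c div b ^ i mod b"

lemma rec_fun_digit [intro!]: "rec_fun c \<Longrightarrow> rec_fun b \<Longrightarrow> rec_fun i \<Longrightarrow>
  rec_fun (\<lambda>e. digit (c e) (b e) (i e))"
  unfolding digit_def by (intro rec_fun_mod rec_fun_div rec_fun_power)

lemma ex_digit: "\<exists>c b. \<forall>i<n. digit c b i = f i"
proof -
  define b where "b = Suc (\<Sum>i<n. f i)"
  have b: "f i < b" if "i < n" for i
    using that unfolding b_def by (simp add: less_Suc_eq_le member_le_sum)
  have "\<exists>c. \<forall>i<n. digit c b i = f i" using b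
  proof (induction n arbitrary: f)
    case (Suc n)
    from Suc.IH[of "\<lambda>i. f (Suc i)"] Suc.prems obtain c where
      c: "\<And>i. i < n \<Longrightarrow> digit c b i = f (Suc i)" by auto
    have "f 0 < b" using Suc.prems by simp
    then have "digit (f 0 + b * c) b 0 = f 0" "\<And>i. digit (f 0 + b * c) b (Suc i) = digit c b i"
      by (simp_all add: digit_def div_mult2_eq)
    with c have "digit (f 0 + b * c) b i = f i" if "i < Suc n" for i
      using that by (cases i) auto
    then show ?case by blast
  qed simp
  then show ?thesis by blast
qed

inductive_cases eval_PrimRecE: "eval X (PrimRec p q) xs y"

lemma eval_PrimRec_iff:
  "eval X (PrimRec p q) (n # xs) y \<longleftrightarrow>
    (\<exists>f. eval X p xs (f 0) \<and> (\<forall>i<n. eval X q (i # f i # xs) (f (Suc i))) \<and> f n = y)"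
proof (induction n arbitrary: y)
  case 0
  show ?case by (auto intro: eval.PrimRec_0 elim: eval_PrimRec_0E)
next
  case (Suc n)
  show ?case
  proof
    assume "eval X (PrimRec p q) (Suc n # xs) y"
    then obtain z where z: "eval X (PrimRec p q) (n # xs) z" "eval X q (n # z # xs) y"
      by (elim eval_PrimRec_SucE)
    from z(1) Suc.IH obtain f where
      "eval X p xs (f 0) \<and> (\<forall>i<n. eval X q (i # f i # xs) (f (Suc i))) \<and> f n = z" by blast
    with z(2) show "\<exists>f. eval X p xs (f 0) \<and> (\<forall>i<Suc n. eval X q (i # f i # xs) (f (Suc i))) \<and>
      f (Suc n) = y"
      by (intro exI[of _ "f(Suc n := y)"]) (auto simp: less_Suc_eq)
  next
    assume "\<exists>f. eval X p xs (f 0) \<and> (\<forall>i<Suc n. eval X q (i # f i # xs) (f (Suc i))) \<and> f (Suc n) = y"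
    then obtain f where f: "eval X p xs (f 0)" "\<forall>i<Suc n. eval X q (i # f i # xs) (f (Suc i))"
      "f (Suc n) = y"
      by blast
    then have "eval X (PrimRec p q) (n # xs) (f n)" unfolding Suc.IH by (intro exI[of _ f]) simp
    with f show "eval X (PrimRec p q) (Suc n # xs) y"
      by (auto intro: eval.PrimRec_Suc)
  qed
qed

lemma sig1_finite_conj:
  assumes "\<And>i. i < (l::nat) \<Longrightarrow> sig1 (P i)"
  shows "sig1 (\<lambda>e. \<forall>i<l. P i e)"
  using assms
proof (induction l)
  case 0
  show ?case by (simp add: sig1.rec_rel rec_rel_const)
next
  case (Suc l)
  then have "sig1 (\<lambda>e. (\<forall>i<l. P i e) \<and> P l e)" by (intro sig1.conj) auto
  moreover have "(\<lambda>e. \<forall>i<Suc l. P i e) = (\<lambda>e. (\<forall>i<l. P i e) \<and> P l e)"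
    by (auto simp: less_Suc_eq)
  ultimately show ?case by simp
qed

text \<open>The induction is on a fixed program, so neither a numbering of programs nor a universal
  program is needed. The length \<open>k\<close> must stay arbitrary, since subprograms run on lists
  of other lengths. Finite oracles suffice because only finite stems are ever consulted.\<close>

lemma sig1_eval:
  assumes "rec_fun h" "rec_fun y" "\<And>i. rec_fun (\<lambda>e. a e i)"
  shows "sig1 (\<lambda>e. eval (set_decode (h e)) p (map (a e) [0..<k]) (y e))"
  using assms
proof (induction p arbitrary: h y a k)
  case Zero
  have "eval X Zero xs z \<longleftrightarrow> z = 0" for X xs z by (auto intro: eval.Zero elim: eval_ZeroE)
  with Zero show ?case by (auto intro!: sig1.rec_rel)
next
  case Succ
  have *: "eval X Succ xs z \<longleftrightarrow> (\<exists>x. xs = [x] \<and> z = Suc x)" for X xs z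
    by (auto intro: eval.Succ elim: eval_SuccE)
  show ?case
  proof (cases "k = 1")
    case True
    with Succ show ?thesis by (auto intro!: sig1.rec_rel simp: *)
  next
    case False
    then have "map (a e) [0..<k] \<noteq> [x]" for e x by (auto dest: arg_cong[where f = length])
    then show ?thesis by (simp add: * sig1.rec_rel rec_rel_const)
  qed
next
  case Oracle
  have *: "eval X Oracle xs z \<longleftrightarrow> (\<exists>x. xs = [x] \<and> (x \<in> X \<and> z = 1 \<or> x \<notin> X \<and> z = 0))" for X xs z
    by (auto intro: eval.Oracle[of X, THEN back_subst[of "eval X Oracle _"]] elim: eval_OracleE)
  show ?case
  proof (cases "k = 1")
    case True
    with Oracle show ?thesis by (auto intro!: sig1.rec_rel simp: *)
  next
    case False
    then have "map (a e) [0..<k] \<noteq> [x]" for e x by (auto dest: arg_cong[where f = length])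
    then show ?thesis by (simp add: * sig1.rec_rel rec_rel_const)
  qed
next
  case (Proj i)
  have "eval X (Proj i) xs z \<longleftrightarrow> i < length xs \<and> z = xs ! i" for X xs z
    by (auto intro: eval.Proj elim: eval_ProjE)
  then have *: "eval X (Proj i) (map (a e) [0..<k]) z \<longleftrightarrow> i < k \<and> z = a e i" for X e z by auto
  show ?case unfolding * using Proj by (auto intro!: sig1.rec_rel)
next
  case (Comp p qs)
  define l where "l = length qs"
  have *: "eval X (Comp p qs) xs z \<longleftrightarrow>
      (\<exists>c b. (\<forall>i<l. eval X (qs ! i) xs (digit c b i)) \<and> eval X p (map (digit c b) [0..<l]) z)"
      for X xs z
  proof
    assume "eval X (Comp p qs) xs z"
    then obtain ys where ys: "list_all2 (\<lambda>q y. eval X q xs y) qs ys" "eval X p ys z"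
      by (rule eval_CompE)
    obtain c b where cb: "\<And>i. i < l \<Longrightarrow> digit c b i = ys ! i"
      using ex_digit[of l "(!) ys"] by blast
    moreover have "map (digit c b) [0..<l] = ys"
      using cb list_all2_lengthD[OF ys(1)] by (intro nth_equalityI) (auto simp: l_def)
    ultimately show "\<exists>c b. (\<forall>i<l. eval X (qs ! i) xs (digit c b i)) \<and>
      eval X p (map (digit c b) [0..<l]) z"
      using ys by (intro exI[of _ c] exI[of _ b]) (auto simp: list_all2_conv_all_nth l_def)
  next
    assume "\<exists>c b. (\<forall>i<l. eval X (qs ! i) xs (digit c b i)) \<and> eval X p (map (digit c b) [0..<l]) z"
    then show "eval X (Comp p qs) xs z"
      by (auto intro!: eval.Comp simp: list_all2_conv_all_nth l_def)
  qed
  show ?case unfolding *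
    by (intro sig1.ex sig1.conj sig1_finite_conj Comp.IH rec_fun_digit rec_fun_var rec_fun_const
        Comp.prems[THEN rec_fun_subst]) (simp add: l_def)
next
  case (PrimRec p q)
  show ?case
  proof (cases k)
    case 0
    have "\<not> eval X (PrimRec p q) [] z" for X z by (auto elim: eval_PrimRecE)
    with 0 show ?thesis by (simp add: sig1.rec_rel rec_rel_const)
  next
    case (Suc k')
    have m: "map (a e) [0..<k] = a e 0 # map (\<lambda>i. a e (Suc i)) [0..<k']" for e
      using map_push[of "a e 0" "\<lambda>i. a e (Suc i)" k'] Suc
        by (simp add: upt_conv_Cons map_Suc_upt[symmetric] o_def del: upt_Suc map_Suc_upt)
    have m2: "i # u # map g [0..<k'] = map (i ## u ## g) [0..<Suc (Suc k')]"
      for i u and g :: "nat \<Rightarrow> nat"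
      by (simp only: map_push)
    have *: "eval X (PrimRec p q) (n # xs) z \<longleftrightarrow> (\<exists>c b. eval X p xs (digit c b 0) \<and>
        (\<forall>i<n. eval X q (i # digit c b i # xs) (digit c b (Suc i))) \<and> digit c b n = z)" for X n xs z
      unfolding eval_PrimRec_iff
    proof
      assume "\<exists>f. eval X p xs (f 0) \<and> (\<forall>i<n. eval X q (i # f i # xs) (f (Suc i))) \<and> f n = z"
      then obtain f where f: "eval X p xs (f 0) \<and> (\<forall>i<n. eval X q (i # f i # xs) (f (Suc i))) \<and>
        f n = z"
        by blast
      obtain c b where "\<forall>i<Suc n. digit c b i = f i"
        using ex_digit[of "Suc n" f] by blast
      with f show "\<exists>c b. eval X p xs (digit c b 0) \<and>
        (\<forall>i<n. eval X q (i # digit c b i # xs) (digit c b (Suc i))) \<and> digit c b n = z"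
        by (intro exI[of _ c] exI[of _ b]) auto
    qed blast
    show ?thesis unfolding m * m2
      by (intro sig1.ex sig1.conj sig1.ball PrimRec.IH sig1.rec_rel rec_rel_eq rec_fun_push
        rec_fun_digit rec_fun_var rec_fun_const rec_fun_Suc
          PrimRec.prems[THEN rec_fun_subst])
  qed
next
  case (Mu p)
  have m: "n # map g [0..<k] = map (n ## g) [0..<Suc k]" for n and g :: "nat \<Rightarrow> nat"
    by (simp only: map_push)
  have *: "eval X (Mu p) xs n \<longleftrightarrow> eval X p (n # xs) 0 \<and> (\<forall>m<n. \<exists>v. eval X p (m # xs) (Suc v))"
    for X xs n
    by (auto intro: eval.Mu elim: eval_MuE)
  show ?case unfolding * m
    by (intro sig1.ex sig1.conj sig1.ball Mu.IH rec_fun_push rec_fun_var rec_fun_const rec_fun_Suc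
      Mu.prems[THEN rec_fun_subst] Mu.prems)
qed

section \<open>Effectively open predicates of a set\<close>

lemma agree_sym: "agree m X Y \<Longrightarrow> agree m Y X"
  by (simp add: agree_def)

lemma agree_trans: "agree m X Y \<Longrightarrow> agree m Y Z \<Longrightarrow> agree m X Z"
  by (simp add: agree_def)

text \<open>Koenig's lemma: \<open>ext m D\<close> says that the first \<open>m\<close> bits of
  \<open>D\<close> survive in every \<open>K s\<close>. If both continuations by one bit died, at
  \<open>s\<close> and \<open>t\<close>, both would be dead at \<open>max s t\<close>, where
  \<open>D\<close> still has an extension. The limit of such a path lies in every \<open>K s\<close>
  because the complements are open.\<close>

lemma nested_closed_nonempty:
  fixes K :: "nat \<Rightarrow> nat set set"
  assumes dec: "\<And>s. K (Suc s) \<subseteq> K s" and ne: "\<And>s. K s \<noteq> {}"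
    and closed: "\<And>s X. X \<notin> K s \<Longrightarrow> \<exists>m. \<forall>Y. agree m X Y \<longrightarrow> Y \<notin> K s"
  shows "\<exists>X. \<forall>s. X \<in> K s"
proof -
  define ext where "ext m D \<longleftrightarrow> (\<forall>s. \<exists>X\<in>K s. agree m D X)" for m D
  have anti: "K t \<subseteq> K s" if "s \<le> t" for s t
    using lift_Suc_antimono_le[of K, OF dec that] .
  have step: "\<exists>D'. ext (Suc m) D' \<and> agree m D D'" if D: "ext m D" for m D
  proof (rule ccontr)
    assume "\<not> ?thesis"
    moreover have "agree m D (insert m D)" "agree m D (D - {m})" by (auto simp: agree_def)
    ultimately have "\<not> ext (Suc m) (insert m D)" "\<not> ext (Suc m) (D - {m})" by auto
    then obtain s t where s: "\<And>X. X \<in> K s \<Longrightarrow> \<not> agree (Suc m) (insert m D) X"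
      and t: "\<And>X. X \<in> K t \<Longrightarrow> \<not> agree (Suc m) (D - {m}) X" unfolding ext_def by blast
    obtain X where X: "X \<in> K (max s t)" "agree m D X" using D unfolding ext_def by blast
    then have "X \<in> K s" "X \<in> K t" using anti[of s "max s t"] anti[of t "max s t"] by auto
    with s t X(2) show False by (cases "m \<in> X") (fastforce simp: agree_def less_Suc_eq)+
  qed
  have "\<exists>D. \<forall>m. ext m (D m) \<and> agree m (D m) (D (Suc m))"
  proof (rule dependent_nat_choice)
    have "ext 0 {}" using ne by (auto simp: ext_def agree_def)
    then show "\<exists>D. ext 0 D" ..
  qed (rule step)
  then obtain D where D: "\<And>m. ext m (D m)" "\<And>m. agree m (D m) (D (Suc m))" by blast
  define X where "X = {i. i \<in> D (Suc i)}"
  have agr: "agree m (D m) (D (m + j))" for m j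
  proof (induction j)
    case (Suc j)
    then show ?case using agree_trans agree_mono[OF D(2)[of "m + j"], of m] by auto
  qed (simp add: agree_def)
  have X: "agree m (D m) X" for m
    unfolding agree_def X_def
  proof (intro allI impI)
    fix i assume "i < m"
    with agr[of "Suc i" "m - Suc i"] show "i \<in> D m \<longleftrightarrow> i \<in> {i. i \<in> D (Suc i)}"
      by (simp add: agree_def)
  qed
  have "X \<in> K s" for s
  proof (rule ccontr)
    assume "X \<notin> K s"
    then obtain m where "\<And>Y. agree m X Y \<Longrightarrow> Y \<notin> K s" using closed by blast
    moreover obtain Y where "Y \<in> K s" "agree m (D m) Y" using D(1) unfolding ext_def by blast
    ultimately show False using X agree_sym agree_trans by blast
  qed
  then show ?thesis by blast
qed

lemma compact_uniform:
  fixes R :: "nat \<Rightarrow> nat set \<Rightarrow> bool"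
  assumes ex: "\<And>X. \<exists>m. R m X"
    and mono: "\<And>m X. R m X \<Longrightarrow> R (Suc m) X"
    and local: "\<And>m X Y. agree m X Y \<Longrightarrow> R m X \<Longrightarrow> R m Y"
  shows "\<exists>m. \<forall>X. R m X"
proof (rule ccontr)
  assume none: "\<not> ?thesis"
  then have "\<exists>X. \<forall>s. X \<in> {X. \<not> R s X}"
  proof (intro nested_closed_nonempty)
    show "\<exists>m. \<forall>Y. agree m X Y \<longrightarrow> Y \<notin> {X. \<not> R s X}" if "X \<notin> {X. \<not> R s X}" for s X
      using that local[of s X] by blast
  qed (use none mono in auto)
  with ex show False by blast
qed

section \<open>Codes of initial segments, and joins of sets\<close>

definition init_code :: "nat set \<Rightarrow> nat \<Rightarrow> nat" where
  "init_code E m = set_encode (E \<inter> {..<m})"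

lemma decode_init_code [simp]: "set_decode (init_code E m) = E \<inter> {..<m}"
  by (simp add: init_code_def)

lemma mem_decode_less: "i \<in> set_decode u \<Longrightarrow> i < u"
proof -
  assume "i \<in> set_decode u"
  then have "u div 2 ^ i \<noteq> 0" by (auto simp: set_decode_def intro: odd_pos)
  then have "2 ^ i \<le> u" by (metis div_less not_le)
  then show ?thesis using less_exp[of i] by linarith
qed

lemma decode_bounded: "u < 2 ^ m \<Longrightarrow> set_decode u \<subseteq> {..<m}"
proof
  fix i assume u: "u < 2 ^ m" and "i \<in> set_decode u"
  then have "u div 2 ^ i \<noteq> 0" by (auto simp: set_decode_def intro: odd_pos)
  then have "2 ^ i \<le> u" by (metis div_less not_le)
  with u have "(2::nat) ^ i < 2 ^ m" by linarith
  then show "i \<in> {..<m}" by simp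
qed

lemma init_code_less: "init_code E m < 2 ^ m"
proof -
  have "init_code E m \<le> set_encode {..<m}"
    unfolding init_code_def set_encode_def by (intro sum_mono2) auto
  also have "\<dots> = 2 ^ m - 1"
    unfolding set_encode_def by (induction m) auto
  also have "\<dots> < 2 ^ m" by simp
  finally show ?thesis .
qed

lemma init_code_decode: "u < 2 ^ m \<Longrightarrow> init_code (set_decode u) m = u"
  unfolding init_code_def using decode_bounded[of u m] by (simp add: Int_absorb2)

lemma init_code_cong: "agree m X Y \<Longrightarrow> init_code X m = init_code Y m"
  unfolding init_code_def agree_def by (rule arg_cong[of _ _ set_encode]) auto

lemma eq_pre_iff: "w < 2 ^ m \<Longrightarrow> w = init_code E m \<longleftrightarrow> (\<forall>i<m. i \<in> set_decode w \<longleftrightarrow> i \<in> E)"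
  using init_code_decode[of w m] init_code_cong[of m "set_decode w" E] by (auto simp: agree_def)

lemma all_init_code: "(\<forall>u<2 ^ m. F u) \<longleftrightarrow> (\<forall>X. F (init_code X m))"
proof
  assume F: "\<forall>X. F (init_code X m)"
  show "\<forall>u<2 ^ m. F u"
  proof (intro allI impI)
    fix u :: nat assume "u < 2 ^ m"
    then have "init_code (set_decode u) m = u" by (rule init_code_decode)
    with F show "F u" by metis
  qed
qed (simp add: init_code_less)

definition join :: "nat set \<Rightarrow> nat set \<Rightarrow> nat set" where
  "join X E = {2 * x | x. x \<in> X} \<union> {Suc (2 * y) | y. y \<in> E}"

lemma join_iff [simp]: "2 * x \<in> join X E \<longleftrightarrow> x \<in> X" "Suc (2 * x) \<in> join X E \<longleftrightarrow> x \<in> E"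
  unfolding join_def by (auto, presburger+)

lemma join_parts [simp]: "{x. 2 * x \<in> join X E} = X" "{y. Suc (2 * y) \<in> join X E} = E"
  by simp_all

lemma agree_join: "agree m X X' \<Longrightarrow> agree m E E' \<Longrightarrow> agree m (join X E) (join X' E')"
  unfolding agree_def
proof (intro allI impI)
  fix i assume *: "\<forall>i<m. (i \<in> X) = (i \<in> X')" "\<forall>i<m. (i \<in> E) = (i \<in> E')" "i < m"
  show "i \<in> join X E \<longleftrightarrow> i \<in> join X' E'"
  proof (cases "even i")
    case True
    then obtain j where "i = 2 * j" by (elim evenE)
    with * show ?thesis by simp
  next
    case False
    then obtain j where "i = Suc (2 * j)" by (elim oddE) simp
    with * show ?thesis by simp
  qed
qed

text \<open>
  Open conditions on \<open>E\<close> that are read off an initial segment. For \<open>K = sig2\<close> these are the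
  relations \<open>\<Sigma>\<^sub>1\<close> in \<open>E\<close> and the halting problem, so no computation relative to both has to be
  formalised.
\<close>

definition eff_open :: "(((nat \<Rightarrow> nat) \<Rightarrow> bool) \<Rightarrow> bool) \<Rightarrow> ((nat \<Rightarrow> nat) \<Rightarrow> nat set \<Rightarrow> bool) \<Rightarrow> bool" where
  "eff_open K P \<longleftrightarrow> (\<exists>Q. K Q \<and> (\<forall>e E. P e E \<longleftrightarrow> (\<exists>m. Q (m ## init_code E m ## e))) \<and>
     (\<forall>e E m. Q (m ## init_code E m ## e) \<longrightarrow> Q (Suc m ## init_code E (Suc m) ## e)))"

section \<open>Closure properties of effectively open predicates\<close>

context bounded_class begin

lemma eff_openI:
  assumes "K (\<lambda>e. Q (e 0) (e 1) (\<lambda>i. e (Suc (Suc i))))" "\<And>e E. P e E \<longleftrightarrow> (\<exists>m. Q m (init_code E m) e)"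
    and "\<And>e E m. Q m (init_code E m) e \<Longrightarrow> Q (Suc m) (init_code E (Suc m)) e"
  shows "eff_open K P"
  unfolding eff_open_def using assms
  by (intro exI[of _ "\<lambda>e. Q (e 0) (e 1) (\<lambda>i. e (Suc (Suc i)))"]) simp

lemma eff_openE:
  assumes "eff_open K P"
  obtains Q where
    "\<And>t u \<sigma>. rec_fun t \<Longrightarrow> rec_fun u \<Longrightarrow> (\<And>i. rec_fun (\<lambda>e. \<sigma> e i)) \<Longrightarrow> K (\<lambda>e. Q (t e) (u e) (\<sigma> e))"
    and "\<And>e E. P e E \<longleftrightarrow> (\<exists>m. Q m (init_code E m) e)"
    and "\<And>e E m n. Q m (init_code E m) e \<Longrightarrow> m \<le> n \<Longrightarrow> Q n (init_code E n) e"
proof -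
  obtain R where R: "K R" "\<And>e E. P e E \<longleftrightarrow> (\<exists>m. R (m ## init_code E m ## e))"
    "\<And>e E m. R (m ## init_code E m ## e) \<Longrightarrow> R (Suc m ## init_code E (Suc m) ## e)"
    using assms unfolding eff_open_def by blast
  have *: "R (n ## init_code E n ## e)" if "R (m ## init_code E m ## e)" "m \<le> n" for e E m n
    using that(2,1) by (induction rule: dec_induct) (auto intro: R(3))
  show ?thesis
    by (rule that[of "\<lambda>m c e. R (m ## c ## e)"])
      (auto intro: subst[OF R(1)] rec_fun_push * simp: R(2))
qed

lemma eff_open_base: "K P \<Longrightarrow> eff_open K (\<lambda>e E. P e)"
  by (rule eff_openI[of "\<lambda>m c e. P e"]) (auto intro: subst rec_fun_var)

lemma eff_open_subst:
  assumes "eff_open K P" and s: "\<And>i. rec_fun (\<lambda>e. \<sigma> e i)"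
  shows "eff_open K (\<lambda>e E. P (\<sigma> e) E)"
proof -
  obtain Q where Q: "\<And>t u \<sigma>. rec_fun t \<Longrightarrow> rec_fun u \<Longrightarrow> (\<And>i. rec_fun (\<lambda>e. \<sigma> e i)) \<Longrightarrow>
    K (\<lambda>e. Q (t e) (u e) (\<sigma> e))"
    "\<And>e E. P e E \<longleftrightarrow> (\<exists>m. Q m (init_code E m) e)"
    "\<And>e E m n. Q m (init_code E m) e \<Longrightarrow> m \<le> n \<Longrightarrow> Q n (init_code E n) e" using eff_openE[OF assms(1)]
    by blast
  show ?thesis
    by (rule eff_openI[of "\<lambda>m c e. Q m c (\<sigma> e)"])
      (auto intro!: Q(1) rec_fun_var rec_fun_subst[OF s] intro: Q(3) simp: Q(2))
qed

lemma eff_open_mem: "rec_fun t \<Longrightarrow> eff_open K (\<lambda>e E. t e \<in> E)"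
  by (rule eff_openI[of "\<lambda>m c e. t e \<in> set_decode c"])
    (auto intro!: rec_rel rec_rel_decode rec_fun_var intro: rec_fun_subst lessI)

lemma eff_open_nmem: "rec_fun t \<Longrightarrow> eff_open K (\<lambda>e E. t e \<notin> E)"
  by (rule eff_openI[of "\<lambda>m c e. t e < m \<and> t e \<notin> set_decode c"])
    (auto intro!: rec_rel rec_rel_not rec_rel_less rec_rel_conj rec_rel_decode rec_fun_var
    intro: rec_fun_subst lessI)

text \<open>Monotonicity in the length of the initial segment allows lengths found separately to be
  raised to a common one. The bounded and the compact universal quantifier below rely on the same
  point.\<close>

lemma eff_open_conj: assumes "eff_open K P" "eff_open K P'"
  shows "eff_open K (\<lambda>e E. P e E \<and> P' e E)"
  and eff_open_disj: "eff_open K (\<lambda>e E. P e E \<or> P' e E)"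
proof -
  obtain Q where Q: "\<And>t u \<sigma>. rec_fun t \<Longrightarrow> rec_fun u \<Longrightarrow> (\<And>i. rec_fun (\<lambda>e. \<sigma> e i)) \<Longrightarrow>
    K (\<lambda>e. Q (t e) (u e) (\<sigma> e))"
    "\<And>e E. P e E \<longleftrightarrow> (\<exists>m. Q m (init_code E m) e)"
    "\<And>e E m n. Q m (init_code E m) e \<Longrightarrow> m \<le> n \<Longrightarrow> Q n (init_code E n) e" using eff_openE[OF assms(1)]
    by blast
  obtain R where R: "\<And>t u \<sigma>. rec_fun t \<Longrightarrow> rec_fun u \<Longrightarrow> (\<And>i. rec_fun (\<lambda>e. \<sigma> e i)) \<Longrightarrow>
    K (\<lambda>e. R (t e) (u e) (\<sigma> e))"
    "\<And>e E. P' e E \<longleftrightarrow> (\<exists>m. R m (init_code E m) e)"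
    "\<And>e E m n. R m (init_code E m) e \<Longrightarrow> m \<le> n \<Longrightarrow> R n (init_code E n) e" using eff_openE[OF assms(2)]
    by blast
  show "eff_open K (\<lambda>e E. P e E \<and> P' e E)"
  proof (rule eff_openI[of "\<lambda>m c e. Q m c e \<and> R m c e"])
    show "P e E \<and> P' e E \<longleftrightarrow> (\<exists>m. Q m (init_code E m) e \<and> R m (init_code E m) e)" for e E
      unfolding Q(2) R(2) using Q(3) R(3) by (meson nle_le)
  qed (auto intro!: conj Q(1) R(1) rec_fun_var intro: Q(3) R(3))
  show "eff_open K (\<lambda>e E. P e E \<or> P' e E)"
    by (rule eff_openI[of "\<lambda>m c e. Q m c e \<or> R m c e"])
      (auto intro!: disj Q(1) R(1) rec_fun_var intro: Q(3) R(3) simp: Q(2) R(2))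
qed

lemma eff_open_ball:
  assumes "eff_open K (\<lambda>e. P (e 0) (\<lambda>i. e (Suc i)))" and b: "rec_fun b"
  shows "eff_open K (\<lambda>e E. \<forall>x<b e. P x e E)"
proof -
  obtain Q where Q: "\<And>t u \<sigma>. rec_fun t \<Longrightarrow> rec_fun u \<Longrightarrow> (\<And>i. rec_fun (\<lambda>e. \<sigma> e i)) \<Longrightarrow>
    K (\<lambda>e. Q (t e) (u e) (\<sigma> e))"
    and "\<And>e E. P (e 0) (\<lambda>i. e (Suc i)) E \<longleftrightarrow> (\<exists>m. Q m (init_code E m) e)"
    and Q3: "\<And>e E m n. Q m (init_code E m) e \<Longrightarrow> m \<le> n \<Longrightarrow> Q n (init_code E n) e"
      using eff_openE[OF assms(1)] by blast
  from this(2)[of "x ## e" for x e] have P: "P x e E \<longleftrightarrow> (\<exists>m. Q m (init_code E m) (x ## e))"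
    for x e E by simp
  show ?thesis
  proof (rule eff_openI[of "\<lambda>m c e. \<forall>x<b e. Q m c (x ## e)"])
    show "(\<forall>x<b e. P x e E) \<longleftrightarrow> (\<exists>m. \<forall>x<b e. Q m (init_code E m) (x ## e))" for e E
    proof
      assume "\<forall>x<b e. P x e E"
      then have "\<forall>x<b e. \<exists>m. Q m (init_code E m) (x ## e)" by (simp only: P)
      from finite_collection[OF this] obtain w where
        "\<forall>x<b e. \<exists>m<w. Q m (init_code E m) (x ## e)" ..
      then have "\<forall>x<b e. Q w (init_code E w) (x ## e)" using Q3 less_imp_le by metis
      then show "\<exists>m. \<forall>x<b e. Q m (init_code E m) (x ## e)" by blast
    qed (auto simp: P)
  qed (auto intro!: ball Q(1) rec_fun_var rec_fun_push rec_fun_subst[OF b] intro: Q3)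
qed

text \<open>\<open>R n\<close> waits until the first \<open>n\<close> bits of \<open>E\<close>
  settle the first \<open>m\<close> bits of the preimage, and finds their code \<open>w\<close> by a
  bounded search. So closure under bounded quantifiers is enough.\<close>

lemma eff_open_set_subst:
  assumes "eff_open K P" and g: "rec_fun (\<lambda>e. g (e 0) (\<lambda>i. e (Suc i)))"
  shows "eff_open K (\<lambda>e E. P e {y. g y e \<in> E})"
proof -
  obtain Q where Q: "\<And>t u \<sigma>. rec_fun t \<Longrightarrow> rec_fun u \<Longrightarrow> (\<And>i. rec_fun (\<lambda>e. \<sigma> e i)) \<Longrightarrow>
    K (\<lambda>e. Q (t e) (u e) (\<sigma> e))"
    "\<And>e E. P e E \<longleftrightarrow> (\<exists>m. Q m (init_code E m) e)"
    "\<And>e E m n. Q m (init_code E m) e \<Longrightarrow> m \<le> n \<Longrightarrow> Q n (init_code E n) e" using eff_openE[OF assms(1)]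
    by blast
  have g': "rec_fun (\<lambda>e. g (t e) (\<sigma> e))" if "rec_fun t" "\<And>i. rec_fun (\<lambda>e. \<sigma> e i)" for t \<sigma>
    using rec_fun_subst[OF g, of "\<lambda>e. t e ## \<sigma> e"] rec_fun_push[OF that] by simp
  define R where "R n c e \<longleftrightarrow> (\<exists>m<Suc n. \<exists>w<2 ^ m. (\<forall>y<m. g y e < n) \<and>
      (\<forall>y<m. y \<in> set_decode w \<longleftrightarrow> g y e \<in> set_decode c) \<and> Q m w e)" for n c e
  have R: "R n (init_code E n) e \<longleftrightarrow> (\<exists>m\<le>n. (\<forall>y<m. g y e < n) \<and> Q m (init_code {y. g y e \<in> E} m) e)"
    for n E e
  proof -
    have "(\<exists>w<2 ^ m. (\<forall>y<m. g y e < n) \<and>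
        (\<forall>y<m. y \<in> set_decode w \<longleftrightarrow> g y e \<in> set_decode (init_code E n)) \<and> Q m w e) \<longleftrightarrow>
      (\<forall>y<m. g y e < n) \<and> Q m (init_code {y. g y e \<in> E} m) e" for m
      using eq_pre_iff[of _ m "{y. g y e \<in> E}"] init_code_less[of "{y. g y e \<in> E}" m] by (auto 4 4)
    then show ?thesis unfolding R_def by (simp add: less_Suc_eq_le)
  qed
  show ?thesis
  proof (rule eff_openI[of R])
    show "K (\<lambda>e. R (e 0) (e 1) (\<lambda>i. e (Suc (Suc i))))"
      unfolding R_def
      by (intro bex conj rec_rel Q rec_rel_ball rec_rel_less rec_rel_iff rec_rel_decode g'
        rec_fun_var rec_fun_push rec_fun_Suc rec_fun_power rec_fun_const)
    show "P e {y. g y e \<in> E} \<longleftrightarrow> (\<exists>n. R n (init_code E n) e)" for e E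
    proof
      assume "P e {y. g y e \<in> E}"
      then obtain m where m: "Q m (init_code {y. g y e \<in> E} m) e" unfolding Q(2) by blast
      have "g y e < Suc (\<Sum>y<m. g y e)" if "y < m" for y
        using that by (intro le_imp_less_Suc member_le_sum) auto
      then have "R (m + Suc (\<Sum>y<m. g y e)) (init_code E (m + Suc (\<Sum>y<m. g y e))) e"
        unfolding R using m by (intro exI[of _ m]) (auto simp: less_Suc_eq_le intro: trans_le_add2)
      then show "\<exists>n. R n (init_code E n) e" by blast
    qed (auto simp: R Q(2))
    show "R n (init_code E n) e \<Longrightarrow> R (Suc n) (init_code E (Suc n)) e" for n E e
      unfolding R by (meson le_Suc_eq less_Suc_eq)
  qed
qed

text \<open>A universal quantifier over sets does not raise the level: by compactness one length
  \<open>m\<close> serves all \<open>X\<close>, and at that length only \<open>2 ^ m\<close> strings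
  have to be checked. In \<open>R\<close>, the number \<open>w\<close> is the string of the
  join.\<close>

lemma eff_open_all_sets:
  assumes "eff_open K (\<lambda>e E. P {x. 2 * x \<in> E} e {y. Suc (2 * y) \<in> E})"
  shows "eff_open K (\<lambda>e E. \<forall>X. P X e E)"
proof -
  obtain Q where Q: "\<And>t u \<sigma>. rec_fun t \<Longrightarrow> rec_fun u \<Longrightarrow> (\<And>i. rec_fun (\<lambda>e. \<sigma> e i)) \<Longrightarrow>
    K (\<lambda>e. Q (t e) (u e) (\<sigma> e))"
    and "\<And>e E. P {x. 2 * x \<in> E} e {y. Suc (2 * y) \<in> E} \<longleftrightarrow> (\<exists>m. Q m (init_code E m) e)"
    and Q3: "\<And>e E m n. Q m (init_code E m) e \<Longrightarrow> m \<le> n \<Longrightarrow> Q n (init_code E n) e"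
      using eff_openE[OF assms(1)] by blast
  from this(2)[of "join X E" for X E] have P: "P X e E \<longleftrightarrow> (\<exists>m. Q m (init_code (join X E) m) e)"
    for X e E by simp
  define R where "R m c e \<longleftrightarrow> (\<forall>u<2 ^ m. \<exists>w<2 ^ m. (\<forall>i<m. i \<in> set_decode w \<longleftrightarrow>
      (\<exists>j<m. i = 2 * j \<and> j \<in> set_decode u) \<or> (\<exists>j<m. i = Suc (2 * j) \<and> j \<in> set_decode c)) \<and>
      Q m w e)" for m c e
  have R: "R m (init_code E m) e \<longleftrightarrow> (\<forall>X. Q m (init_code (join X E) m) e)" for m E e
  proof -
    have join: "i \<in> join X E \<longleftrightarrow> (\<exists>j<m. i = 2 * j \<and> j \<in> set_decode (init_code X m)) \<or>
        (\<exists>j<m. i = Suc (2 * j) \<and> j \<in> set_decode (init_code E m))" if "i < m" for i X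
      using that by (auto simp: join_def)
    have eq: "(\<forall>i<m. i \<in> set_decode w \<longleftrightarrow> (\<exists>j<m. i = 2 * j \<and> j \<in> set_decode (init_code X m)) \<or>
        (\<exists>j<m. i = Suc (2 * j) \<and> j \<in> set_decode (init_code E m))) \<longleftrightarrow> w = init_code (join X E) m"
      if "w < 2 ^ m" for w X
      unfolding eq_pre_iff[OF that] using join[of _ X] by blast
    have "(\<exists>w<2 ^ m. (\<forall>i<m. i \<in> set_decode w \<longleftrightarrow>
      (\<exists>j<m. i = 2 * j \<and> j \<in> set_decode (init_code X m)) \<or> (\<exists>j<m. i = Suc (2 * j) \<and>
      j \<in> set_decode (init_code E m))) \<and> Q m w e)
      \<longleftrightarrow> Q m (init_code (join X E) m) e" for X
      using eq[where X = X] init_code_less[of "join X E" m] by blast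
    note * = this
    have "R m (init_code E m) e \<longleftrightarrow> (\<forall>X. \<exists>w<2 ^ m. (\<forall>i<m. i \<in> set_decode w \<longleftrightarrow>
      (\<exists>j<m. i = 2 * j \<and> j \<in> set_decode (init_code X m)) \<or> (\<exists>j<m. i = Suc (2 * j) \<and>
      j \<in> set_decode (init_code E m))) \<and> Q m w e)"
      unfolding R_def by (rule all_init_code)
    then show ?thesis unfolding * .
  qed
  show ?thesis
  proof (rule eff_openI[of R])
    show "K (\<lambda>e. R (e 0) (e 1) (\<lambda>i. e (Suc (Suc i))))"
      unfolding R_def
      by (intro ball bex conj rec_rel Q rec_rel_ball rec_rel_bex rec_rel_disj rec_rel_conj
        rec_rel_eq rec_rel_iff rec_rel_decode
          rec_fun_var rec_fun_push rec_fun_Suc rec_fun_power rec_fun_mult rec_fun_const)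
    show "(\<forall>X. P X e E) \<longleftrightarrow> (\<exists>m. R m (init_code E m) e)" for e E
    proof
      assume "\<forall>X. P X e E"
      then have "\<exists>m. \<forall>X. Q m (init_code (join X E) m) e"
        unfolding P
      proof (intro compact_uniform[of "\<lambda>m X. Q m (init_code (join X E) m) e"])
        show "Q m (init_code (join Y E) m) e" if "agree m X Y" "Q m (init_code (join X E) m) e"
          for m X Y
          using that init_code_cong[OF agree_join, of m X Y E E] by (simp add: agree_def)
      qed (auto intro: Q3[OF _ le_SucI[OF order_refl]])
      then show "\<exists>m. R m (init_code E m) e" unfolding R .
    qed (auto simp: R P)
    show "R m (init_code E m) e \<Longrightarrow> R (Suc m) (init_code E (Suc m)) e" for m E e
      unfolding R using Q3[of m _ e "Suc m"] by simp
  qed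
qed

end

lemma (in sigma_class) eff_open_ex:
  assumes "eff_open K (\<lambda>e. P (e 0) (\<lambda>i. e (Suc i)))"
  shows "eff_open K (\<lambda>e E. \<exists>x. P x e E)"
proof -
  obtain Q where Q: "\<And>t u \<sigma>. rec_fun t \<Longrightarrow> rec_fun u \<Longrightarrow> (\<And>i. rec_fun (\<lambda>e. \<sigma> e i)) \<Longrightarrow>
    K (\<lambda>e. Q (t e) (u e) (\<sigma> e))"
    and "\<And>e E. P (e 0) (\<lambda>i. e (Suc i)) E \<longleftrightarrow> (\<exists>m. Q m (init_code E m) e)"
    and Q3: "\<And>e E m n. Q m (init_code E m) e \<Longrightarrow> m \<le> n \<Longrightarrow> Q n (init_code E n) e"
      using eff_openE[OF assms(1)] by blast
  from this(2)[of "x ## e" for x e] have P: "P x e E \<longleftrightarrow> (\<exists>m. Q m (init_code E m) (x ## e))"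
    for x e E by simp
  show ?thesis
  proof (rule eff_openI[of "\<lambda>m c e. \<exists>x. Q m c (x ## e)"])
    show "\<exists>x. Q m (init_code E m) (x ## e) \<Longrightarrow> \<exists>x. Q (Suc m) (init_code E (Suc m)) (x ## e)" for e E m
      using Q3[of m E _ "Suc m"] by auto
  qed (auto intro!: ex Q(1) rec_fun_var rec_fun_push simp: P)
qed

lemma (in sigma_class) eff_open_bex:
  assumes "eff_open K (\<lambda>e. P (e 0) (\<lambda>i. e (Suc i)))" and b: "rec_fun b"
  shows "eff_open K (\<lambda>e E. \<exists>x<b e. P x e E)"
  by (intro eff_open_ex eff_open_conj eff_open_base rec_rel rec_rel_less rec_fun_var
    rec_fun_subst[OF b] assms(1))

section \<open>Oracles that do not enumerate the complicated set\<close>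

lemma join_split: "join {x. 2 * x \<in> E} {y. Suc (2 * y) \<in> E} = E"
proof -
  have "i \<in> join {x. 2 * x \<in> E} {y. Suc (2 * y) \<in> E} \<longleftrightarrow> i \<in> E" for i
    by (cases "even i") (auto elim!: evenE oddE)
  then show ?thesis by blast
qed

lemma (in bounded_class) eff_open_all_join:
  assumes "eff_open K P" shows "eff_open K (\<lambda>e E. \<forall>X. P e (join X E))"
  by (rule eff_open_all_sets) (simp add: join_split assms)

lemma (in bounded_class) eff_open_locally_true:
  assumes "eff_open K P" "P e (join X E)"
  shows "\<exists>m. \<forall>Y. agree m X Y \<longrightarrow> P e (join Y E)"
proof -
  obtain Q where Q: "\<And>e E. P e E \<longleftrightarrow> (\<exists>m. Q (m ## init_code E m ## e))"
    using assms(1) unfolding eff_open_def by blast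
  then obtain m where m: "Q (m ## init_code (join X E) m ## e)" using assms(2) by blast
  have "P e (join Y E)" if "agree m X Y" for Y
  proof -
    have "init_code (join X E) m = init_code (join Y E) m"
      using that by (intro init_code_cong agree_join) (auto simp: agree_def)
    with m show ?thesis unfolding Q by metis
  qed
  then show ?thesis by blast
qed

instance recf :: countable by countable_datatype

text \<open>A predicate is determined by a program and an arity. Countability lets
  \<open>good_basis\<close> treat one predicate per stage.\<close>

lemma countable_eff_open_sig2: "countable {P. eff_open sig2 P}"
proof -
  define F where "F = (\<lambda>(p, k) e E. \<exists>m x. \<forall>y. eval {} p (map (y ## x ## m ## init_code E m ## e)
    [0..<k]) 1)"
  have "{P. eff_open sig2 P} \<subseteq> range F"
  proof
    fix P assume "P \<in> {P. eff_open sig2 P}"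
    then obtain Q where Q: "sig2 Q" "\<And>e E. P e E \<longleftrightarrow> (\<exists>m. Q (m ## init_code E m ## e))"
      unfolding eff_open_def by blast
    obtain R where R: "rec_rel R" "\<And>e. Q e \<longleftrightarrow> (\<exists>x. \<forall>y. R (y ## x ## e))"
      using Q(1) unfolding sig2_iff_rec_rel by blast
    obtain k p where p: "\<And>e. eval {} p (map e [0..<k]) (if R e then 1 else 0)"
      using R(1) unfolding rec_rel_def rec_fun_def by blast
    have "R e \<longleftrightarrow> eval {} p (map e [0..<k]) 1" for e
      using p[of e] eval_deterministic[OF p[of e], of 1] by (auto split: if_splits)
    then have "P = F (p, k)" unfolding F_def by (intro ext) (simp add: Q(2) R(2))
    then show "P \<in> range F" by blast
  qed
  then show ?thesis by (rule countable_subset) (rule countable_image, simp)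
qed

text \<open>Many-one reducibility suffices, because sets are recovered from oracles only as halves
  of a join or as columns, and it is easily substituted into open predicates.\<close>

definition reducible :: "nat set \<Rightarrow> nat set \<Rightarrow> bool" where
  "reducible E E' \<longleftrightarrow> (\<exists>g. rec_fun (\<lambda>e. g (e 0)) \<and> E = {y. g y \<in> E'})"

lemma reducibleI: "rec_fun (\<lambda>e. g (e 0)) \<Longrightarrow> reducible {y. g y \<in> E} E"
  unfolding reducible_def by blast

lemma reducible_refl: "reducible E E"
  using reducibleI[of "\<lambda>y. y"] rec_fun_var by simp

lemma reducible_trans: assumes "reducible E E'" "reducible E' E''" shows "reducible E E''"
proof -
  obtain g h where g: "rec_fun (\<lambda>e. g (e 0))" "E = {y. g y \<in> E'}" and h: "rec_fun (\<lambda>e. h (e 0))"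
    "E' = {y. h y \<in> E''}"
    using assms unfolding reducible_def by blast
  have "rec_fun (\<lambda>e. h (g (e 0)))" using rec_fun_subst[OF h(1), of "\<lambda>e _. g (e 0)"] g(1) by simp
  with g(2) h(2) show ?thesis unfolding reducible_def by (intro exI[of _ "\<lambda>y. h (g y)"]) auto
qed

lemma reducible_join: "reducible X (join X E)" "reducible E (join X E)"
  using reducibleI[of "\<lambda>x. 2 * x" "join X E"] reducibleI[of "\<lambda>x. Suc (2 * x)" "join X E"]
  by (simp_all add: rec_fun_var rec_fun_Suc rec_fun_mult rec_fun_const)

lemma eff_open_reducible:
  assumes "eff_open sig2 P" "reducible E E'"
  obtains P' where "eff_open sig2 P'" "\<And>e. P e E \<longleftrightarrow> P' e E'"
proof -
  obtain g where g: "rec_fun (\<lambda>e. g (e 0))" "E = {y. g y \<in> E'}" using assms(2)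
    unfolding reducible_def by blast
  have "eff_open sig2 (\<lambda>e E. P e {y. g y \<in> E})"
    by (rule sig2.eff_open_set_subst[OF assms(1)]) (rule g(1))
  then show ?thesis using that g(2) by blast
qed

locale not_Sigma2 =
  fixes B :: "nat set"
  assumes not_Sigma2: "\<not> Sigma2 B"
begin

text \<open>\<open>B\<close> is not \<open>\<Sigma>\<^sub>1\<close> in \<open>E\<close> and the halting problem.\<close>

definition good :: "nat set \<Rightarrow> bool" where
  "good E \<longleftrightarrow> (\<forall>P. eff_open sig2 P \<longrightarrow> B \<noteq> {n. P (\<lambda>_. n) E})"

lemma goodD:
  assumes "good E" "eff_open sig2 P" shows "B \<noteq> {n. P (n ## c) E}"
proof -
  have "eff_open sig2 (\<lambda>e. P (e 0 ## c))"
    by (intro sig2.eff_open_subst[OF assms(2)] rec_fun_push rec_fun_var rec_fun_const)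
  with assms(1) show ?thesis unfolding good_def by blast
qed

lemma good_empty: "good {}"
  unfolding good_def
proof (intro allI impI)
  fix P assume "eff_open sig2 P"
  then obtain Q where Q: "sig2 Q" "\<And>e E. P e E \<longleftrightarrow> (\<exists>m. Q (m ## init_code E m ## e))"
    unfolding eff_open_def by blast
  \<comment> \<open>Every initial segment of the empty set has code 0, so the oracle
    disappears.\<close>
  have "sig2 (\<lambda>e. \<exists>m. Q (m ## 0 ## (\<lambda>_. e 0)))"
    by (intro sig2.ex sig2.subst[OF Q(1)] rec_fun_push rec_fun_var rec_fun_const)
  from Sigma2_if_sig2[OF this, of "\<lambda>_. 0"] not_Sigma2
  have "B \<noteq> {n. \<exists>m. Q (m ## 0 ## (\<lambda>_. n))}" by auto
  then show "B \<noteq> {n. P (\<lambda>_. n) {}}" by (simp add: Q(2) init_code_def)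
qed

text \<open>
  If the closed class given by \<open>P\<close> cannot be shrunk so as to keep some \<open>n \<in> B\<close> out of the set
  defined by \<open>Q\<close>, then the numbers which the class forces in form an effectively open set
  containing \<open>B\<close>.
\<close>

lemma good_basis_step:
  assumes E: "good E" and P: "eff_open sig2 P" and X0: "\<not> P c (join X0 E)" and Q: "eff_open sig2 Q"
  shows "\<exists>P'. eff_open sig2 P' \<and> (\<exists>X. \<not> P' c (join X E)) \<and> (\<forall>X. P c (join X E) \<longrightarrow> P' c (join X E)) \<and>
    (\<forall>X. \<not> P' c (join X E) \<longrightarrow> B \<noteq> {n. Q (\<lambda>_. n) (join X E)})"
proof (cases "\<exists>n\<in>B. \<exists>X. \<not> P c (join X E) \<and> \<not> Q (\<lambda>_. n) (join X E)")
  case True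
  then obtain n X where n: "n \<in> B" "\<not> P c (join X E)" "\<not> Q (\<lambda>_. n) (join X E)" by blast
  have "eff_open sig2 (\<lambda>e E. P e E \<or> Q (\<lambda>_. n) E)"
    by (intro sig2.eff_open_disj P sig2.eff_open_subst[OF Q] rec_fun_const)
  then show ?thesis using n by (intro exI[of _ "\<lambda>e E. P e E \<or> Q (\<lambda>_. n) E"]) blast
next
  case False
  have "eff_open sig2 (\<lambda>e E. \<forall>X. P c (join X E) \<or> Q (\<lambda>_. e 0) (join X E))"
    by (intro sig2.eff_open_all_join sig2.eff_open_disj sig2.eff_open_subst[OF P]
      sig2.eff_open_subst[OF Q] rec_fun_const rec_fun_var)
  \<comment> \<open>The forced numbers contain \<open>B\<close> but do not equal it, so some
    \<open>n\<close> outside \<open>B\<close> is forced in. Every member of the class already errs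
    at this \<open>n\<close>, and \<open>P\<close> can be kept.\<close>
  from goodD[OF E this, of c] have "B \<noteq> {n. \<forall>X. P c (join X E) \<or> Q (\<lambda>_. n) (join X E)}" by simp
  with False obtain n where "n \<notin> B" "\<forall>X. P c (join X E) \<or> Q (\<lambda>_. n) (join X E)" by blast
  with P X0 show ?thesis by (intro exI[of _ P]) blast
qed

text \<open>A basis theorem of cone avoidance type: one step is applied for each open predicate, and
  the decreasing nonempty closed classes have a common member.\<close>

lemma good_basis:
  assumes E: "good E" and P: "eff_open sig2 P" and X0: "\<not> P c (join X0 E)"
  shows "\<exists>X. \<not> P c (join X E) \<and> good (join X E)"
proof -
  define S where "S = from_nat_into {P. eff_open sig2 P}"
  have ne: "{P. eff_open sig2 P} \<noteq> {}" using P by blast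
  have S: "eff_open sig2 (S s)" for s using from_nat_into[OF ne] by (auto simp: S_def)
  define valid where "valid P \<longleftrightarrow> eff_open sig2 P \<and> (\<exists>X. \<not> P c (join X E))" for P
  have "\<exists>F. F 0 = P \<and> (\<forall>s. valid (F s) \<and> ((\<forall>X. F s c (join X E) \<longrightarrow> F (Suc s) c (join X E)) \<and>
      (\<forall>X. \<not> F (Suc s) c (join X E) \<longrightarrow> B \<noteq> {n. S s (\<lambda>_. n) (join X E)})))"
  proof -
    have "\<exists>F. \<forall>s. (valid (F s) \<and> (s = 0 \<longrightarrow> F s = P)) \<and> ((\<forall>X. F s c (join X E) \<longrightarrow>
      F (Suc s) c (join X E)) \<and>
      (\<forall>X. \<not> F (Suc s) c (join X E) \<longrightarrow> B \<noteq> {n. S s (\<lambda>_. n) (join X E)}))"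
    proof (rule dependent_nat_choice)
      show "\<exists>F. valid F \<and> (0 = 0 \<longrightarrow> F = P)" using P X0 valid_def by blast
    next
      fix F and s :: nat assume "valid F \<and> (s = 0 \<longrightarrow> F = P)"
      then show "\<exists>F'. (valid F' \<and> (Suc s = 0 \<longrightarrow> F' = P)) \<and> (\<forall>X. F c (join X E) \<longrightarrow> F' c (join X E)) \<and>
          (\<forall>X. \<not> F' c (join X E) \<longrightarrow> B \<noteq> {n. S s (\<lambda>_. n) (join X E)})"
        using good_basis_step[OF E _ _ S[of s], of F] unfolding valid_def by blast
    qed
    then show ?thesis by blast
  qed
  then obtain F where F: "F 0 = P" "\<And>s. valid (F s)"
    "\<And>s X. F s c (join X E) \<Longrightarrow> F (Suc s) c (join X E)"
    "\<And>s X. \<not> F (Suc s) c (join X E) \<Longrightarrow> B \<noteq> {n. S s (\<lambda>_. n) (join X E)}" by blast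
  have "\<exists>X. \<forall>s. X \<in> {X. \<not> F s c (join X E)}"
  proof (rule nested_closed_nonempty)
    show "{X. \<not> F (Suc s) c (join X E)} \<subseteq> {X. \<not> F s c (join X E)}" for s using F(3) by blast
    show "{X. \<not> F s c (join X E)} \<noteq> {}" for s using F(2)[of s] by (auto simp: valid_def)
    show "\<exists>m. \<forall>Y. agree m X Y \<longrightarrow> Y \<notin> {X. \<not> F s c (join X E)}" if "X \<notin> {X. \<not> F s c (join X E)}"
      for s X
      using sig2.eff_open_locally_true[of "F s" c X E] F(2)[of s] that by (auto simp: valid_def)
  qed
  then obtain X where X: "\<And>s. \<not> F s c (join X E)" by blast
  have "B \<noteq> {n. Q (\<lambda>_. n) (join X E)}" if Q: "eff_open sig2 Q" for Q
  proof -
    obtain s where "S s = Q"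
      using from_nat_into_surj[OF countable_eff_open_sig2, of Q] Q by (auto simp: S_def)
    with F(4)[OF X] show ?thesis by blast
  qed
  with X[of 0] F(1) show ?thesis unfolding good_def by blast
qed

text \<open>The only way in which \<open>good\<close> enters the forcing question: the numbers
  accepted for all \<open>X\<close> form a set of the class that \<open>B\<close> avoids, so there
  is a disagreement. In the second case the basis theorem also makes the rejecting \<open>X\<close>
  harmless.\<close>

lemma good_dichotomy:
  assumes E: "good E" and P: "eff_open sig2 P"
  obtains n where "n \<notin> B" "\<And>X. P (n ## c) (join X E)"
  | n X where "n \<in> B" "\<not> P (n ## c) (join X E)" "good (join X E)"
proof -
  have "B \<noteq> {n. \<forall>X. P (n ## c) (join X E)}"
    by (intro goodD[OF E sig2.eff_open_all_join] P)
  then consider n where "n \<notin> B" "\<And>X. P (n ## c) (join X E)"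
    | n X where "n \<in> B" "\<not> P (n ## c) (join X E)" by blast
  then show thesis
  proof cases
    case 2
    from good_basis[of E P "n ## c" X, OF E P 2(2)] 2(1) that(2) show thesis by blast
  qed (rule that(1))
qed

end

section \<open>Large collections of families\<close>

text \<open>
  A set \<open>V\<close> of codes of finite sets stands for the upward closed open family of all \<open>Y\<close> with
  \<open>meets Y V\<close>; \<open>positive C Y\<close> says that \<open>Y\<close> belongs to all families of \<open>C\<close>.
\<close>

definition meets :: "nat set \<Rightarrow> nat set \<Rightarrow> bool" where
  "meets Y V \<longleftrightarrow> (\<exists>u\<in>V. set_decode u \<subseteq> Y)"

definition positive :: "nat set set \<Rightarrow> nat set \<Rightarrow> bool" where
  "positive C Y \<longleftrightarrow> (\<forall>V\<in>C. meets Y V)"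

definition large :: "nat set set \<Rightarrow> nat set \<Rightarrow> bool" where
  "large C Z \<longleftrightarrow> (\<forall>\<Y>. finite \<Y> \<longrightarrow> Z \<subseteq> \<Union>\<Y> \<longrightarrow> (\<exists>Y\<in>\<Y>. positive C Y))"

lemma meets_mono: "meets Y V \<Longrightarrow> Y \<subseteq> Y' \<Longrightarrow> V \<subseteq> V' \<Longrightarrow> meets Y' V'"
  unfolding meets_def by blast

lemma positive_mono: "positive C Y \<Longrightarrow> Y \<subseteq> Y' \<Longrightarrow> C' \<subseteq> C \<Longrightarrow> positive C' Y'"
  unfolding positive_def using meets_mono by blast

lemma positive_insert: "positive (insert V C) Y \<longleftrightarrow> meets Y V \<and> positive C Y"
  unfolding positive_def by blast

lemma large_mono:
  assumes "large C Z" "Z \<subseteq> Z'" "\<And>Y. positive C Y \<Longrightarrow> positive C' Y"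
  shows "large C' Z'"
  unfolding large_def
proof (intro allI impI)
  fix \<Y> assume "finite \<Y>" "Z' \<subseteq> \<Union>\<Y>"
  with assms(1,2) obtain Y where "Y \<in> \<Y>" "positive C Y" unfolding large_def by (meson order_trans)
  with assms(3) show "\<exists>Y\<in>\<Y>. positive C' Y" by blast
qed

lemma large_antimono: "large C Z \<Longrightarrow> Z \<subseteq> Z' \<Longrightarrow> C' \<subseteq> C \<Longrightarrow> large C' Z'"
  using large_mono positive_mono[OF _ order_refl] by metis

lemma large_imp_positive: "large C Z \<Longrightarrow> positive C Z"
  unfolding large_def by (metis Union_insert ccpo_Sup_singleton finite.emptyI finite_insert
    order_refl singletonD)

lemma not_large_empty: "\<not> large C {}"
  unfolding large_def by (intro notI) (drule spec[of _ "{}"], simp)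

lemma not_large_iff:
  "\<not> large C Z \<longleftrightarrow> (\<exists>k Y. (\<forall>j<k. \<not> positive C (Y j)) \<and> Z \<subseteq> (\<Union>j<(k::nat). Y j))"
proof
  assume "\<not> large C Z"
  then obtain \<Y> where Y: "finite \<Y>" "Z \<subseteq> \<Union>\<Y>" "\<forall>Y\<in>\<Y>. \<not> positive C Y" unfolding large_def by blast
  obtain h where "bij_betw h {0..<card \<Y>} \<Y>" using ex_bij_betw_nat_finite[OF Y(1)] by blast
  then have "h ` {..<card \<Y>} = \<Y>" by (simp add: bij_betw_def atLeast0LessThan)
  with Y show "\<exists>k Y. (\<forall>j<k. \<not> positive C (Y j)) \<and> Z \<subseteq> (\<Union>j<(k::nat). Y j)"
    by (intro exI[of _ "card \<Y>"] exI[of _ h]) auto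
next
  assume "\<exists>k Y. (\<forall>j<k. \<not> positive C (Y j)) \<and> Z \<subseteq> (\<Union>j<(k::nat). Y j)"
  then obtain k :: nat and Y where "\<forall>j<k. \<not> positive C (Y j)" "Z \<subseteq> \<Union>(Y ` {..<k})" by blast
  then show "\<not> large C Z" unfolding large_def by (intro notI) (drule spec[of _ "Y ` {..<k}"], auto)
qed

lemma large_Un: assumes "large C (Z \<union> Z')" shows "large C Z \<or> large C Z'"
proof (rule ccontr)
  assume "\<not> ?thesis"
  then obtain \<Y> \<Y>' where "finite \<Y>" "Z \<subseteq> \<Union>\<Y>" "\<forall>Y\<in>\<Y>. \<not> positive C Y"
    "finite \<Y>'" "Z' \<subseteq> \<Union>\<Y>'" "\<forall>Y\<in>\<Y>'. \<not> positive C Y" unfolding large_def by blast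
  then have "finite (\<Y> \<union> \<Y>')" "Z \<union> Z' \<subseteq> \<Union>(\<Y> \<union> \<Y>')" "\<forall>Y\<in>\<Y> \<union> \<Y>'. \<not> positive C Y" by auto
  with assms show False unfolding large_def by blast
qed

text \<open>Being infinite is not an open condition, so it is broken into the open conditions of
  reaching beyond \<open>N\<close>.\<close>

definition tail :: "nat \<Rightarrow> nat set" where "tail N = {u. \<exists>i\<in>set_decode u. N \<le> i}"

lemma meets_tail: "meets Y (tail N) \<longleftrightarrow> (\<exists>i\<in>Y. N \<le> i)"
proof
  assume "\<exists>i\<in>Y. N \<le> i"
  then obtain i where "i \<in> Y" "N \<le> i" by blast
  moreover obtain u where "set_decode u = {i}" using set_encode_inverse[of "{i}"] by blast
  ultimately show "meets Y (tail N)"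
    unfolding meets_def tail_def by (intro bexI[of _ u]) auto
qed (auto simp: meets_def tail_def)

lemma positive_tails_infinite: "range tail \<subseteq> C \<Longrightarrow> positive C Y \<Longrightarrow> infinite Y"
proof -
  assume "range tail \<subseteq> C" "positive C Y"
  then have "\<exists>i\<in>Y. N \<le> i" for N unfolding meets_tail[symmetric] positive_def by blast
  then show "infinite Y" unfolding infinite_nat_iff_unbounded_le by blast
qed

lemma large_inter_atLeast:
  assumes "range tail \<subseteq> C" "large C Z" shows "large C (Z \<inter> {m..})"
proof -
  have "Z = (Z \<inter> {m..}) \<union> (Z \<inter> {..<m})" by auto
  then have "large C (Z \<inter> {m..}) \<or> large C (Z \<inter> {..<m})" using assms(2) large_Un by metis
  moreover have "\<not> large C (Z \<inter> {..<m})"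
    using large_imp_positive positive_tails_infinite[OF assms(1)] by blast
  ultimately show ?thesis by blast
qed

section \<open>C.e. families, and covers coded by a single set\<close>

definition ce :: "nat set \<Rightarrow> bool" where
  "ce V \<longleftrightarrow> (\<exists>T c. sig1 T \<and> V = {u. T (u ## c)})"

lemma ceI: "sig1 T \<Longrightarrow> ce {u. T (u ## c)}"
  unfolding ce_def by blast

lemma ce_empty: "ce {}"
  using ceI[OF sig1.rec_rel[OF rec_rel_const[of False]]] by simp

lemma ce_tail: "ce (tail N)"
proof -
  have "sig1 (\<lambda>e. \<exists>i. i \<in> set_decode (e 0) \<and> N \<le> i)"
    by (intro sig1.ex sig1.rec_rel rec_rel_conj rec_rel_decode rec_rel_le rec_fun_var rec_fun_const)
  from ceI[OF this] show ?thesis by (simp add: tail_def Bex_def)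
qed

lemma finite_case_ce:
  assumes "\<And>j. j < k \<Longrightarrow> ce (D j)"
  shows "\<exists>Q. sig1 Q \<and> (\<forall>j<k. \<forall>u e. Q (j ## u ## e) \<longleftrightarrow> u \<in> D j)"
proof -
  have "\<exists>Q. sig1 Q \<and> (\<forall>j<k. \<forall>e. Q (j ## e) \<longleftrightarrow> e 0 \<in> D j)"
  proof (rule finite_case_sig1)
    fix j assume "j < k"
    then obtain T c where T: "sig1 T" "D j = {u. T (u ## c)}" using assms unfolding ce_def by blast
    then show "sig1 (\<lambda>e. e 0 \<in> D j)"
      by (auto intro!: sig1.subst[OF T(1)] rec_fun_push rec_fun_var rec_fun_const)
  qed
  then obtain Q where "sig1 Q" "\<forall>j<k. \<forall>e. Q (j ## e) \<longleftrightarrow> e 0 \<in> D j" by blast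
  then show ?thesis by (intro exI[of _ Q]) simp
qed

text \<open>One set carries \<open>k\<close> sets, so that a quantifier over covers is a quantifier
  over a single \<open>X\<close>, within reach of compactness and of the basis theorem.\<close>

definition column :: "nat \<Rightarrow> nat set \<Rightarrow> nat \<Rightarrow> nat set" where
  "column k X j = {i. k * i + j \<in> X}"

lemma ex_column: "\<exists>X. \<forall>j<k. column k X j = Y j"
proof -
  have "i = i' \<and> j = j'" if "k * i + j = k * i' + j'" "j < k" "j' < k" for i i' j j' :: nat
  proof -
    have "(k * i + j) div k = i" "(k * i' + j') div k = i'" using that(2,3) by auto
    with that(1) show ?thesis by auto
  qed
  then have "column k {k * i + j | i j. j < k \<and> i \<in> Y j} j = Y j" if "j < k" for j
    using that unfolding column_def by blast
  then show ?thesis by blast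
qed

lemma rec_rel_decode_subset: "rec_fun f \<Longrightarrow> rec_fun g \<Longrightarrow> rec_rel (\<lambda>e. set_decode (f e) \<subseteq> set_decode
  (g e))"
proof -
  assume *: "rec_fun f" "rec_fun g"
  have "rec_rel (\<lambda>e. \<forall>i<f e. i \<notin> set_decode (f e) \<or> i \<in> set_decode (g e))"
    by (intro rec_rel_ball rec_rel_disj rec_rel_not rec_rel_decode rec_fun_var *[THEN
      rec_fun_subst] *)
  moreover have "set_decode u \<subseteq> set_decode v \<longleftrightarrow> (\<forall>i<u. i \<notin> set_decode u \<or> i \<in> set_decode v)" for u v
    using mem_decode_less by blast
  ultimately show ?thesis by simp
qed

context sigma_class begin

lemma eff_open_decode_subset:
  assumes u: "rec_fun u" and "rec_fun (\<lambda>e. g (e 0) (\<lambda>i. e (Suc i)))"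
  shows "eff_open K (\<lambda>e E. \<forall>i\<in>set_decode (u e). g i e \<in> E)"
proof -
  have "eff_open K (\<lambda>e E. \<forall>i<u e. i \<notin> set_decode (u e) \<or> g i e \<in> E)"
    by (intro eff_open_ball eff_open_disj eff_open_base rec_rel rec_rel_not rec_rel_decode
      eff_open_mem rec_fun_var rec_fun_subst[OF u] assms)
  moreover have "(\<forall>i\<in>set_decode v. i \<in> F) \<longleftrightarrow> (\<forall>i<v. i \<notin> set_decode v \<or> i \<in> F)" for v F
    using mem_decode_less by blast
  from this[of _ "{i. g i e \<in> E}" for e E] have "(\<forall>i\<in>set_decode (u e). g i e \<in> E) \<longleftrightarrow>
      (\<forall>i<u e. i \<notin> set_decode (u e) \<or> g i e \<in> E)" for e E by simp
  ultimately show ?thesis by simp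
qed

lemma eff_open_at_empty: assumes "eff_open K P" shows "K (\<lambda>e. P e {})"
proof -
  obtain Q where Q: "K Q" "\<And>e E. P e E \<longleftrightarrow> (\<exists>m. Q (m ## init_code E m ## e))"
    using assms unfolding eff_open_def by blast
  have "K (\<lambda>e. \<exists>m. Q (m ## 0 ## e))"
    by (intro ex subst[OF Q(1)] rec_fun_push rec_fun_var rec_fun_const)
  then show ?thesis by (simp add: Q(2) init_code_def)
qed

end

text \<open>
  Largeness is a statement of the form \<open>\<Pi>\<^sub>2\<close>, so \<open>E\<close> and the halting problem enumerate the c.e.
  families that cannot be added to \<open>C\<close>.
\<close>

definition controls :: "nat set \<Rightarrow> nat set set \<Rightarrow> bool" where
  "controls E C \<longleftrightarrow> (\<forall>V\<in>C. ce V) \<and>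
    (\<forall>T. sig1 T \<longrightarrow> (\<exists>P. eff_open sig2 P \<and> (\<forall>e. \<not> large (insert {u. T (u ## e)} C) UNIV \<longleftrightarrow> P e E)))"

lemma controls_reducible: assumes "controls E C" "reducible E E'" shows "controls E' C"
  unfolding controls_def
proof (intro conjI allI impI)
  show "\<forall>V\<in>C. ce V" using assms(1) unfolding controls_def by blast
  fix T assume "sig1 T"
  then obtain P where P: "eff_open sig2 P" "\<And>e. \<not> large (insert {u. T (u ## e)} C) UNIV \<longleftrightarrow> P e E"
    using assms(1) unfolding controls_def by blast
  obtain P' where "eff_open sig2 P'" "\<And>e. P e E \<longleftrightarrow> P' e E'"
    using eff_open_reducible[OF P(1) assms(2)] by blast
  with P(2) show "\<exists>P. eff_open sig2 P \<and> (\<forall>e. \<not> large (insert {u. T (u ## e)} C) UNIV \<longleftrightarrow> P e E')"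
    by blast
qed

text \<open>A part that meets \<open>V\<close> must fail some tail and is finite; all such parts are
  merged into an initial segment below \<open>N\<close>. The others become columns. For fixed
  \<open>k\<close> and \<open>N\<close> what remains is a closed condition on
  \<open>X\<close>.\<close>

lemma not_large_tails_iff:
  "\<not> large (insert V (range tail)) UNIV \<longleftrightarrow>
    (\<exists>k N X. (\<forall>i\<ge>N. \<exists>j<k. i \<in> column k X j) \<and> (\<forall>j<k. \<not> meets (column k X j) V))"
proof
  assume "\<not> large (insert V (range tail)) UNIV"
  then obtain \<Y> where Y: "finite \<Y>" "UNIV \<subseteq> \<Union>\<Y>" "\<And>Y. Y \<in> \<Y> \<Longrightarrow> \<not> positive (insert V (range tail)) Y"
    unfolding large_def by blast
  define \<Z> where "\<Z> = {Y \<in> \<Y>. \<not> meets Y V}"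
  have "finite Y" if "Y \<in> \<Y> - \<Z>" for Y
  proof -
    have "\<not> positive (range tail) Y" using that Y(3)[of Y] by (auto simp: \<Z>_def positive_insert)
    then obtain N where "\<forall>i\<in>Y. i < N" by (auto simp: positive_def meets_tail not_le)
    then show ?thesis by (intro finite_subset[of Y "{..<N}"]) auto
  qed
  then have "finite (\<Union>(\<Y> - \<Z>))" using Y(1) by blast
  then obtain N where N: "\<Union>(\<Y> - \<Z>) \<subseteq> {..<N}" using finite_nat_iff_bounded by blast
  have "finite \<Z>" using Y(1) by (simp add: \<Z>_def)
  then obtain h where "bij_betw h {0..<card \<Z>} \<Z>" using ex_bij_betw_nat_finite by blast
  then have h: "h ` {..<card \<Z>} = \<Z>" by (simp add: bij_betw_def atLeast0LessThan)
  obtain X where X: "\<forall>j<card \<Z>. column (card \<Z>) X j = h j" using ex_column[of "card \<Z>" h] by blast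
  show "\<exists>k N X. (\<forall>i\<ge>N. \<exists>j<k. i \<in> column k X j) \<and> (\<forall>j<k. \<not> meets (column k X j) V)"
  proof (rule exI[of _ "card \<Z>"], rule exI[of _ N], rule exI[of _ X], intro conjI allI impI)
    fix i assume "N \<le> i"
    obtain Y where "Y \<in> \<Y>" "i \<in> Y" using Y(2) by blast
    with N \<open>N \<le> i\<close> have "Y \<in> \<Z>" by force
    then have "Y \<in> h ` {..<card \<Z>}" by (simp only: h)
    then obtain j where "j < card \<Z>" "h j = Y" by blast
    with X \<open>i \<in> Y\<close> show "\<exists>j<card \<Z>. i \<in> column (card \<Z>) X j" by blast
  next
    fix j assume "j < card \<Z>"
    with h X show "\<not> meets (column (card \<Z>) X j) V" by (auto simp: \<Z>_def)
  qed
next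
  assume "\<exists>k N X. (\<forall>i\<ge>N. \<exists>j<k. i \<in> column k X j) \<and> (\<forall>j<k. \<not> meets (column k X j) V)"
  then obtain k N X where X: "\<forall>i\<ge>N. \<exists>j<k. i \<in> column k X j" "\<forall>j<k. \<not> meets (column k X j) V"
    by blast
  let ?\<Y> = "insert {..<N} (column k X ` {..<k})"
  have "UNIV \<subseteq> \<Union>?\<Y>" using X(1) by auto (meson lessThan_iff not_less)
  moreover have "\<not> positive (insert V (range tail)) Y" if "Y \<in> ?\<Y>" for Y
    using that X(2) by (auto simp: positive_insert positive_def meets_tail intro!: exI[of _ N])
  ultimately show "\<not> large (insert V (range tail)) UNIV"
    unfolding large_def not_all not_imp by (intro exI[of _ ?\<Y>]) blast
qed

lemma controls_tails: "controls E (range tail)"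
  unfolding controls_def
proof (intro conjI allI impI ballI)
  show "ce V" if "V \<in> range tail" for V using that ce_tail by blast
  fix T assume T: "sig1 T"
  \<comment> \<open>Here \<open>e 0\<close> is the number of columns and \<open>e 1\<close> the
    bound \<open>N\<close>; \<open>P\<close> says that \<open>X\<close> does not witness failure of
    largeness. That it holds for all \<open>X\<close> is \<open>\<Sigma>\<^sub>1\<close> by
    compactness, and negating this below two number quantifiers gives
    \<open>\<Sigma>\<^sub>2\<close>.\<close>
  define P where "P e E \<longleftrightarrow> (\<exists>i. e 1 \<le> i \<and> (\<forall>j<e 0. 2 * (e 0 * i + j) \<notin> E)) \<or>
    (\<exists>j<e 0. \<exists>u. T (u ## (\<lambda>i. e (Suc (Suc i)))) \<and> (\<forall>i\<in>set_decode u. 2 * (e 0 * i + j) \<in> E))"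
    for e :: "nat \<Rightarrow> nat" and E
  have "eff_open sig1 P"
    unfolding P_def
    by (intro sig1.eff_open_disj sig1.eff_open_conj sig1.eff_open_ex sig1.eff_open_bex
      sig1.eff_open_ball sig1.eff_open_base
        sig1.eff_open_nmem sig1.eff_open_decode_subset sig1.subst[OF T] sig1.rec_rel rec_rel_le
        rec_fun_push rec_fun_add rec_fun_mult rec_fun_var rec_fun_const)
  then have *: "sig1 (\<lambda>e. \<forall>X. P e (join X {}))"
    by (intro sig1.eff_open_at_empty[of "\<lambda>e E. \<forall>X. P e (join X E)"] sig1.eff_open_all_join)
  have "sig2 (\<lambda>e. \<not> (\<forall>X. P (e 1 ## e 0 ## (\<lambda>i. e (Suc (Suc i)))) (join X {})))"
    by (rule sig2.subst[OF sig2_not_sig1[OF *], of "\<lambda>e. e 1 ## e 0 ## (\<lambda>i. e (Suc (Suc i)))"])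
      (intro rec_fun_push rec_fun_var)
  then have "sig2 (\<lambda>e. \<exists>k N. \<not> (\<forall>X. P (k ## N ## e) (join X {})))"
    by (intro sig2.ex) simp
  moreover have "\<not> large (insert {u. T (u ## e)} (range tail)) UNIV \<longleftrightarrow>
      (\<exists>k N. \<not> (\<forall>X. P (k ## N ## e) (join X {})))" for e
  proof -
    have "\<not> P (k ## N ## e) (join X {}) \<longleftrightarrow> (\<forall>i\<ge>N. \<exists>j<k. i \<in> column k X j) \<and>
        (\<forall>j<k. \<not> meets (column k X j) {u. T (u ## e)})" for k N X
      unfolding P_def meets_def column_def subset_iff
      by (simp only: join_iff nat.case One_nat_def mem_Collect_eq bex_simps not_ex de_Morgan_disj)
        blast
    then show ?thesis unfolding not_large_tails_iff by simp
  qed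
  ultimately show "\<exists>P. eff_open sig2 P \<and> (\<forall>e. \<not> large (insert {u. T (u ## e)} (range tail)) UNIV \<longleftrightarrow>
    P e E)"
    by (intro exI[of _ "\<lambda>e E. \<exists>k N. \<not> (\<forall>X. P (k ## N ## e) (join X {}))"])
      (simp add: sig2.eff_open_base)
qed

lemma large_tails: "large (range tail) UNIV"
  unfolding large_def
proof (intro allI impI)
  fix \<Y> :: "nat set set" assume "finite \<Y>" "UNIV \<subseteq> \<Union>\<Y>"
  moreover from this have "infinite (\<Union>\<Y>)" by (simp add: top.extremum_unique)
  ultimately obtain Y where "Y \<in> \<Y>" "infinite Y" by blast
  then show "\<exists>Y\<in>\<Y>. positive (range tail) Y"
    by (intro bexI[of _ Y]) (auto simp: positive_def meets_tail infinite_nat_iff_unbounded_le)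
qed

text \<open>The intersection of two open families. It is needed because \<open>controls\<close>
  speaks of adding one family only.\<close>

definition inter_fam :: "nat set \<Rightarrow> nat set \<Rightarrow> nat set" where
  "inter_fam V W = {u. (\<exists>a\<in>V. set_decode a \<subseteq> set_decode u) \<and> (\<exists>b\<in>W. set_decode b \<subseteq> set_decode u)}"

lemma meets_inter_fam: "meets Y (inter_fam V W) \<longleftrightarrow> meets Y V \<and> meets Y W"
proof
  assume "meets Y V \<and> meets Y W"
  then obtain a b where "a \<in> V" "b \<in> W" "set_decode a \<subseteq> Y" "set_decode b \<subseteq> Y"
    unfolding meets_def by blast
  then show "meets Y (inter_fam V W)"
    unfolding meets_def inter_fam_def
    by (intro bexI[of _ "set_encode (set_decode a \<union> set_decode b)"]) auto
qed (auto simp: meets_def inter_fam_def)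

text \<open>The families \<open>W b v\<close> shrink as \<open>b\<close> and \<open>v\<close> grow,
  so finitely many failures against the system are failures against a single member. Hence
  \<open>V\<close> is incompatible with \<open>C'\<close> iff \<open>inter_fam V (W b v)\<close> is
  incompatible with \<open>C\<close> for some pair, and this search over pairs stays at the same
  level in \<open>E'\<close>.\<close>

lemma directed_controls:
  fixes W :: "nat \<Rightarrow> nat \<Rightarrow> nat set"
  assumes C: "controls E C" and E': "reducible E E'" "reducible X E'" and T: "sig1 T"
    and W: "\<And>b v. W b v = {u. T (u ## b ## v ## c)}"
    and anti: "\<And>b v b' v'. b \<le> b' \<Longrightarrow> set_decode v \<subseteq> set_decode v' \<Longrightarrow> W b' v' \<subseteq> W b v"
    and large: "\<And>b v. set_decode v \<subseteq> X \<Longrightarrow> large (insert (W b v) C) UNIV"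
  defines "C' \<equiv> C \<union> {W b v | b v. set_decode v \<subseteq> X}"
  shows "controls E' C'" "large C' UNIV"
proof -
  have iff: "\<not> large (insert V C') UNIV \<longleftrightarrow>
      (\<exists>b v. set_decode v \<subseteq> X \<and> \<not> large (insert (inter_fam V (W b v)) C) UNIV)" for V
  proof
    assume "\<not> large (insert V C') UNIV"
    then obtain k :: nat and Y where Y: "\<And>j. j < k \<Longrightarrow> \<not> positive (insert V C') (Y j)"
      "UNIV \<subseteq> (\<Union>j<k. Y j)"
      unfolding not_large_iff by blast
    have "\<exists>b v. j < k \<longrightarrow> set_decode v \<subseteq> X \<and> \<not> positive (insert (inter_fam V (W b v)) C) (Y j)" for j
    proof (cases "j < k \<and> meets (Y j) V \<and> positive C (Y j)")
      case True
      then have "\<not> positive C' (Y j)" using Y(1)[of j] by (simp add: positive_insert)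
      then obtain V' where "V' \<in> C'" "\<not> meets (Y j) V'" unfolding positive_def by blast
      moreover from this True have "V' \<notin> C" unfolding positive_def by blast
      ultimately obtain b v where "set_decode v \<subseteq> X" "\<not> meets (Y j) (W b v)"
        unfolding C'_def by blast
      then show ?thesis by (auto simp: positive_insert meets_inter_fam)
    next
      case False
      then show ?thesis
        by (intro exI[of _ 0] exI[of _ 0]) (auto simp: positive_insert meets_inter_fam)
    qed
    then obtain b v where bv: "\<And>j. j < k \<Longrightarrow> set_decode (v j) \<subseteq> X"
      "\<And>j. j < k \<Longrightarrow> \<not> positive (insert (inter_fam V (W (b j) (v j))) C) (Y j)" by metis
    define b' where "b' = (\<Sum>j<k. b j)"
    define v' where "v' = set_encode (\<Union>j<k. set_decode (v j))"
    have v': "set_decode v' = (\<Union>j<k. set_decode (v j))" unfolding v'_def by simp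
    have "\<not> positive (insert (inter_fam V (W b' v')) C) (Y j)" if "j < k" for j
    proof -
      have "b j \<le> b'" unfolding b'_def using that by (intro member_le_sum) auto
      moreover have "set_decode (v j) \<subseteq> set_decode v'" unfolding v' using that by blast
      ultimately have "W b' v' \<subseteq> W (b j) (v j)" by (rule anti)
      with bv(2)[OF that] show ?thesis
        by (auto simp: positive_insert meets_inter_fam dest: meets_mono)
    qed
    with Y(2) have "\<not> large (insert (inter_fam V (W b' v')) C) UNIV" unfolding not_large_iff
      by blast
    moreover have "set_decode v' \<subseteq> X" unfolding v' using bv(1) by blast
    ultimately show "\<exists>b v. set_decode v \<subseteq> X \<and> \<not> large (insert (inter_fam V (W b v)) C) UNIV"
      by blast
  next
    assume "\<exists>b v. set_decode v \<subseteq> X \<and> \<not> large (insert (inter_fam V (W b v)) C) UNIV"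
    then obtain b v where bv: "set_decode v \<subseteq> X" "\<not> large (insert (inter_fam V (W b v)) C) UNIV"
      by blast
    have "positive (insert (inter_fam V (W b v)) C) Y" if "positive (insert V C') Y" for Y
    proof -
      have "meets Y V" "positive C' Y" using that by (simp_all add: positive_insert)
      moreover from this(2) have "meets Y (W b v)" "positive C Y"
        using bv(1) unfolding C'_def positive_def by blast+
      ultimately show ?thesis by (simp add: positive_insert meets_inter_fam)
    qed
    with bv(2) show "\<not> large (insert V C') UNIV" using large_mono[OF _ order_refl] by blast
  qed
  show "large C' UNIV"
  proof (rule ccontr)
    assume "\<not> large C' UNIV"
    \<comment> \<open>Every set meets the family \<open>UNIV\<close>, since 0 codes the empty set;
      adding it changes nothing but allows \<open>iff\<close> to be applied to \<open>C'\<close>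
      itself.\<close>
    then have "\<not> large (insert UNIV C') UNIV" using large_antimono by blast
    then obtain b v where "set_decode v \<subseteq> X" and *: "\<not> large (insert (inter_fam UNIV (W b v)) C)
      UNIV"
      unfolding iff by blast
    then have "large (insert (W b v) C) UNIV" by (intro large)
    moreover have "meets Y UNIV" for Y unfolding meets_def by (intro bexI[of _ 0]) auto
    then have "positive (insert (inter_fam UNIV (W b v)) C) Y \<longleftrightarrow> positive (insert (W b v) C) Y" for Y
      by (simp add: positive_insert meets_inter_fam)
    ultimately show False using * large_mono[OF _ order_refl] by blast
  qed
  show "controls E' C'"
    unfolding controls_def
  proof (intro conjI allI impI ballI)
    fix V assume "V \<in> C'"
    with C show "ce V" unfolding C'_def controls_def W by (auto intro: ceI[OF T])
  next
    fix S assume S: "sig1 S"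
    \<comment> \<open>The arguments are the code \<open>u\<close>, then \<open>b\<close> and
      \<open>v\<close>, then the parameters of \<open>S\<close>: the intersections are c.e.
      uniformly in \<open>b\<close> and \<open>v\<close>.\<close>
    define S' where "S' e \<longleftrightarrow>
        (\<exists>a. S (a ## (\<lambda>i. e (Suc (Suc (Suc i))))) \<and> set_decode a \<subseteq> set_decode (e 0)) \<and>
        (\<exists>a. T (a ## e 1 ## e 2 ## c) \<and> set_decode a \<subseteq> set_decode (e 0))" for e
    have "sig1 S'"
      unfolding S'_def
      by (intro sig1.conj sig1.ex sig1.subst[OF S] sig1.subst[OF T] sig1.rec_rel
        rec_rel_decode_subset
          rec_fun_push rec_fun_var rec_fun_const)
    then obtain P0 where "eff_open sig2 P0" "\<And>e. \<not> large (insert {u. S' (u ## e)} C) UNIV \<longleftrightarrow> P0 e E"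
      using C unfolding controls_def by blast
    then obtain P where P: "eff_open sig2 P" "\<And>e. \<not> large (insert {u. S' (u ## e)} C) UNIV \<longleftrightarrow> P e E'"
      using eff_open_reducible[OF _ E'(1)] by metis
    have S': "{u. S' (u ## b ## v ## e)} = inter_fam {u. S (u ## e)} (W b v)" for b v e
      unfolding S'_def inter_fam_def W by (auto simp: numeral_2_eq_2)
    obtain g where g: "rec_fun (\<lambda>e. g (e 0))" "X = {y. g y \<in> E'}" using E'(2)
      unfolding reducible_def by blast
    have "eff_open sig2 (\<lambda>e E. \<exists>b v. (\<forall>i\<in>set_decode v. g i \<in> E) \<and> P (b ## v ## e) E)"
      by (intro sig2.eff_open_ex sig2.eff_open_conj sig2.eff_open_decode_subset
        sig2.eff_open_subst[OF P(1)]
          rec_fun_push rec_fun_var g(1))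
    moreover have "\<not> large (insert {u. S (u ## e)} C') UNIV \<longleftrightarrow>
        (\<exists>b v. (\<forall>i\<in>set_decode v. g i \<in> E') \<and> P (b ## v ## e) E')" for e
      unfolding iff S'[symmetric] P(2) g(2) by blast
    ultimately show "\<exists>P. eff_open sig2 P \<and> (\<forall>e. \<not> large (insert {u. S (u ## e)} C') UNIV \<longleftrightarrow> P e E')"
      by blast
  qed
qed

section \<open>The forcing question\<close>

lemma reducible_column: "reducible (column k X j) (join X E)"
proof -
  have "rec_fun (\<lambda>e. 2 * (k * e 0 + j))" by (intro rec_fun_mult rec_fun_add rec_fun_const
    rec_fun_var)
  from reducibleI[OF this, of "join X E"] show ?thesis unfolding column_def by (simp only: join_iff)
qed

text \<open>Covers of \<open>Z\<close> whose parts miss prescribed c.e. families form a closed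
  class, the kind to which the basis theorem applies. Equality with \<open>Z\<close>, instead of
  inclusion, keeps the parts inside \<open>Z\<close>.\<close>

lemma eff_open_no_cover:
  assumes Z: "reducible Z E" and D: "\<And>j. j < k \<Longrightarrow> ce (D j)"
  shows "\<exists>P. eff_open sig2 P \<and> (\<forall>e X. P e (join X E) \<longleftrightarrow>
    \<not> (Z = (\<Union>j<k. column k X j) \<and> (\<forall>j<k. \<not> meets (column k X j) (D j))))"
proof -
  obtain g where g: "rec_fun (\<lambda>e. g (e 0))" "Z = {y. g y \<in> E}" using Z unfolding reducible_def
    by blast
  obtain Q where Q: "sig1 Q" "\<forall>j<k. \<forall>u e. Q (j ## u ## e) \<longleftrightarrow> u \<in> D j"
    using finite_case_ce[of k D] D by blast
  define P where "P e E \<longleftrightarrow>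
      (\<exists>i. (Suc (2 * g i) \<in> E \<and> (\<forall>j<k. 2 * (k * i + j) \<notin> E)) \<or>
           (Suc (2 * g i) \<notin> E \<and> (\<exists>j<k. 2 * (k * i + j) \<in> E))) \<or>
      (\<exists>j<k. \<exists>u. Q (j ## u ## e) \<and> (\<forall>i\<in>set_decode u. 2 * (k * i + j) \<in> E))" for e E
  have g': "rec_fun (\<lambda>e. g (e i))" for i
    using rec_fun_subst[OF g(1), of "\<lambda>e _. e i"] rec_fun_var by simp
  have "eff_open sig2 P"
    unfolding P_def
    by (intro sig2.eff_open_disj sig2.eff_open_conj sig2.eff_open_ex sig2.eff_open_bex
      sig2.eff_open_ball sig2.eff_open_base
        sig2.eff_open_mem sig2.eff_open_nmem sig2.eff_open_decode_subset sig1_imp_sig2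
        sig1.subst[OF Q(1)] g'
        rec_fun_push rec_fun_Suc rec_fun_add rec_fun_mult rec_fun_var rec_fun_const)
  moreover have "P e (join X E) \<longleftrightarrow>
    \<not> (Z = (\<Union>j<k. column k X j) \<and> (\<forall>j<k. \<not> meets (column k X j) (D j)))" for e X
  proof -
    have Zeq: "Z = (\<Union>j<k. column k X j) \<longleftrightarrow> (\<forall>i. g i \<in> E \<longleftrightarrow> (\<exists>j<k. k * i + j \<in> X))"
      unfolding g(2) column_def by blast
    have D: "(\<exists>u. Q (j ## u ## e) \<and> (\<forall>i\<in>set_decode u. k * i + j \<in> X)) \<longleftrightarrow> meets (column k X j) (D j)"
      if "j < k" for j
      using Q(2) that unfolding meets_def column_def by blast
    show ?thesis unfolding P_def join_iff Zeq using D by blast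
  qed
  ultimately show ?thesis by blast
qed

context not_Sigma2 begin

text \<open>The given cover may be of any complexity; the basis theorem trades it for one that keeps
  the oracle good.\<close>

lemma good_cover:
  assumes "good E" "reducible Z E" and D: "\<And>j. j < k \<Longrightarrow> ce (D j)"
    and Y: "Z = (\<Union>j<k. Y j)" "\<And>j. j < k \<Longrightarrow> \<not> meets (Y j) (D j)"
  obtains X where "good (join X E)" "Z = (\<Union>j<k. column k X j)" "\<And>j. j < k \<Longrightarrow>
    \<not> meets (column k X j) (D j)"
proof -
  obtain P where P: "eff_open sig2 P" "\<And>e X. P e (join X E) \<longleftrightarrow>
    \<not> (Z = (\<Union>j<k. column k X j) \<and> (\<forall>j<k. \<not> meets (column k X j) (D j)))"
    using eff_open_no_cover[of Z E k D] assms(2) D by blast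
  obtain X0 where "\<forall>j<k. column k X0 j = Y j" using ex_column[of k Y] by blast
  with Y have "Z = (\<Union>j<k. column k X0 j)" "\<forall>j<k. \<not> meets (column k X0 j) (D j)" by auto
  then have "\<not> P (\<lambda>_. 0) (join X0 E)" unfolding P(2) by blast
  from good_basis[OF assms(1) P(1) this] show thesis using that unfolding P(2) by blast
qed

section \<open>Admissible conditions and robust sets\<close>

definition admissible :: "nat set \<Rightarrow> nat set set \<Rightarrow> bool" where
  "admissible E C \<longleftrightarrow> good E \<and> controls E C \<and> range tail \<subseteq> C \<and> large C UNIV"

text \<open>
  Largeness of \<open>Z\<close> is \<open>\<Pi>\<^sub>2\<close> in \<open>Z\<close>, which is beyond \<open>E\<close> and the halting problem. The forcing
  question therefore only mentions largeness of \<open>UNIV\<close>, and robustness transfers the answer to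
  \<open>Z\<close>.
\<close>

definition robust :: "nat set \<Rightarrow> nat set set \<Rightarrow> nat set \<Rightarrow> bool" where
  "robust E C Z \<longleftrightarrow> (\<forall>E' C'. admissible E' C' \<longrightarrow> reducible E E' \<longrightarrow> C \<subseteq> C' \<longrightarrow> large C' Z)"

lemma robust_ext: "robust E C Z \<Longrightarrow> reducible E E' \<Longrightarrow> C \<subseteq> C' \<Longrightarrow> robust E' C' Z"
  unfolding robust_def using reducible_trans by blast

lemma robust_large: "robust E C Z \<Longrightarrow> admissible E C \<Longrightarrow> large C Z"
  unfolding robust_def using reducible_refl by blast

lemma admissible_reducible: "admissible E C \<Longrightarrow> good E' \<Longrightarrow> reducible E E' \<Longrightarrow> admissible E' C"
  unfolding admissible_def using controls_reducible by blast

text \<open>If the last part is not robust, some extension makes it small. It stays small from then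
  on, so by \<open>large_Un\<close> the rest of \<open>Z\<close> is robust there, with one part
  fewer.\<close>

lemma robust_split:
  assumes "admissible E C" "robust E C Z" "Z \<subseteq> (\<Union>j<k. Y j)"
  shows "\<exists>E' C' j. admissible E' C' \<and> reducible E E' \<and> C \<subseteq> C' \<and> j < (k::nat) \<and> robust E' C' (Y j)"
  using assms
proof (induction k arbitrary: E C Z)
  case 0
  then have "large C {}" using robust_large by auto
  with not_large_empty show ?case by blast
next
  case (Suc k)
  show ?case
  proof (cases "robust E C (Y k)")
    case True
    with Suc.prems(1) reducible_refl show ?thesis by blast
  next
    case False
    then obtain E1 C1 where 1: "admissible E1 C1" "reducible E E1" "C \<subseteq> C1" "\<not> large C1 (Y k)"
      unfolding robust_def by blast
    have "robust E1 C1 (Z - Y k)"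
      unfolding robust_def
    proof (intro allI impI)
      fix E2 C2 assume 2: "admissible E2 C2" "reducible E1 E2" "C1 \<subseteq> C2"
      then have "large C2 Z" using Suc.prems(2) reducible_trans[OF 1(2)] 1(3) unfolding robust_def
        by blast
      then have "large C2 ((Z - Y k) \<union> Y k)" by (rule large_antimono) auto
      then have "large C2 (Z - Y k) \<or> large C2 (Y k)" by (rule large_Un)
      moreover have "\<not> large C2 (Y k)" using 1(4) large_antimono[OF _ order_refl 2(3)] by blast
      ultimately show "large C2 (Z - Y k)" by blast
    qed
    moreover have "Z - Y k \<subseteq> (\<Union>j<k. Y j)" using Suc.prems(3) by (auto simp: lessThan_Suc)
    ultimately obtain E' C' j where "admissible E' C'" "reducible E1 E'" "C1 \<subseteq> C'" "j < k"
      "robust E' C' (Y j)"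
      using Suc.IH[OF 1(1), of "Z - Y k"] by blast
    with reducible_trans[OF 1(2)] 1(3) show ?thesis by (meson less_SucI order_trans)
  qed
qed

lemma split_cover:
  assumes "admissible E C" "robust E C Z" "good (join X E)" "Z = (\<Union>j<k. column k X j)"
  obtains E' C' j where "admissible E' C'" "reducible E E'" "C \<subseteq> C'" "j < k"
    "robust E' C' (column k X j)" "reducible (column k X j) E'"
proof -
  have "admissible (join X E) C" "robust (join X E) C Z"
    using assms admissible_reducible robust_ext reducible_join by blast+
  then obtain E' C' j where "admissible E' C'" "reducible (join X E) E'" "C \<subseteq> C'" "j < k"
    "robust E' C' (column k X j)"
    using robust_split[of "join X E" C Z "column k X" k] assms(4) by blast
  with that reducible_trans reducible_join reducible_column show thesis by blast
qed

text \<open>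
  The columns of \<open>X\<close> in \<open>live\<close> carry the requirements: \<open>V j t n x\<close> says that the stem, extended
  by \<open>t\<close>, can be extended further so that \<open>x\<close> no longer witnesses that \<open>n\<close> is in the set defined
  from the generic. The other columns absorb the part of \<open>Z\<close> which is small for \<open>C\<close>, by missing
  a family of \<open>C\<close>. The question is whether for every such cover \<open>X\<close> of \<open>Z\<close> the families \<open>V j t n
  x\<close>, with \<open>t\<close> inside the \<open>j\<close>-th column, are incompatible with \<open>C\<close>; the actual sets \<open>S j\<close> are
  one of the covers.
\<close>

lemma extension:
  assumes admissible: "admissible E C" and robust: "robust E C Z" and Z: "reducible Z E"
    and V: "sig1 T" "\<And>j t n x. V j t n x = {r. T (r ## t ## j ## n ## x ## c)}"
    and live: "live \<subseteq> {..<k}"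
    and dead: "\<And>j. j < k \<Longrightarrow> j \<notin> live \<Longrightarrow> D j \<in> C \<and> \<not> meets (S j) (D j)"
      "\<And>j t n x Y. j < k \<Longrightarrow> j \<notin> live \<Longrightarrow> meets Y (V j t n x)"
    and S: "Z \<subseteq> (\<Union>j<k. S j)"
  shows "\<exists>E' C' Z' n. \<exists>j\<in>live. admissible E' C' \<and> reducible E E' \<and> C \<subseteq> C' \<and> Z' \<subseteq> Z \<and>
    reducible Z' E' \<and> robust E' C' Z' \<and>
    ((n \<notin> B \<and> (\<exists>t x. set_decode t \<subseteq> S j \<inter> Z \<and> \<not> meets Z' (V j t n x))) \<or>
     (n \<in> B \<and> (\<forall>t x Y. set_decode t \<subseteq> Z' \<longrightarrow> positive C' Y \<longrightarrow> meets Y (V j t n x))))"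
proof -
  \<comment> \<open>An intersection of finitely many \<open>V j t n x\<close>: those with
    \<open>t\<close> and \<open>x\<close> below \<open>b\<close> and \<open>t\<close> inside the
    \<open>j\<close>-th column of \<open>v\<close>. It depends only on a finite piece
    \<open>v\<close> of the cover and decreases in \<open>b\<close> and \<open>v\<close>, as
    \<open>directed_controls\<close> requires.\<close>
  define W where "W n b v = {u. \<forall>j<k. \<forall>t<b. \<forall>x<b.
    (\<exists>i<t. i \<in> set_decode t \<and> k * i + j \<notin> set_decode v) \<or>
    (\<exists>r. T (r ## t ## j ## n ## x ## c) \<and> set_decode r \<subseteq> set_decode u)}" for n b v
  define TW where "TW e \<longleftrightarrow> (\<forall>j<k. \<forall>t<e 1. \<forall>x<e 1.
    (\<exists>i<t. i \<in> set_decode t \<and> k * i + j \<notin> set_decode (e 2)) \<or>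
    (\<exists>r. T (r ## t ## j ## e 3 ## x ## c) \<and> set_decode r \<subseteq> set_decode (e 0)))" for e :: "nat \<Rightarrow> nat"
  have TW: "sig1 TW"
    unfolding TW_def
    by (intro sig1.ball sig1.disj sig1.ex sig1.conj sig1.subst[OF V(1)] sig1.rec_rel rec_rel_bex
      rec_rel_conj rec_rel_not
        rec_rel_decode rec_rel_decode_subset rec_fun_push rec_fun_add rec_fun_mult rec_fun_var
        rec_fun_const)
  have WT: "W n b v = {u. TW (u ## b ## v ## n ## c)}" for n b v
    unfolding W_def TW_def by (simp add: numeral_2_eq_2 numeral_3_eq_3)
  have adm: "(\<exists>i<t. i \<in> set_decode t \<and> k * i + j \<notin> set_decode v) \<longleftrightarrow>
      \<not> set_decode t \<subseteq> column k (set_decode v) j" for t j v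
    using mem_decode_less unfolding column_def by blast
  have meets_V: "meets Y (V j t n x)"
    if m: "meets Y (W n b v)" and l: "j < k" "t < b" "x < b"
      "set_decode t \<subseteq> column k (set_decode v) j" for Y j t n x b v
  proof -
    obtain u where u: "u \<in> W n b v" "set_decode u \<subseteq> Y" using m unfolding meets_def by blast
    then obtain r where "T (r ## t ## j ## n ## x ## c)" "set_decode r \<subseteq> set_decode u"
      using l unfolding W_def adm by blast
    with u(2) show ?thesis unfolding meets_def V(2) by blast
  qed
  have meets_W: "meets Y (W n b v)"
    if *: "\<And>j t x. j < k \<Longrightarrow> set_decode t \<subseteq> column k (set_decode v) j \<Longrightarrow> meets Y (V j t n x)"
      for Y n b v
  proof -
    have "\<forall>j t x. \<exists>r. j < k \<and> set_decode t \<subseteq> column k (set_decode v) j \<longrightarrow>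
        T (r ## t ## j ## n ## x ## c) \<and> set_decode r \<subseteq> Y"
      using * unfolding meets_def V(2) by blast
    then obtain r where r: "\<And>j t x. j < k \<Longrightarrow> set_decode t \<subseteq> column k (set_decode v) j \<Longrightarrow>
        T (r j t x ## t ## j ## n ## x ## c) \<and> set_decode (r j t x) \<subseteq> Y" by metis
    define A where "A = {(j, t, x). j < k \<and> t < b \<and> x < b \<and>
      set_decode t \<subseteq> column k (set_decode v) j}"
    have "finite A" unfolding A_def
      by (rule finite_subset[of _ "{..<k} \<times> {..<b} \<times> {..<b}"]) auto
    define u where "u = set_encode (\<Union>(j, t, x)\<in>A. set_decode (r j t x))"
    have u: "set_decode u = (\<Union>(j, t, x)\<in>A. set_decode (r j t x))"
      unfolding u_def using \<open>finite A\<close> by (intro set_encode_inverse) auto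
    have "u \<in> W n b v"
      unfolding W_def adm
    proof (intro CollectI allI impI, unfold disj_not1, intro impI)
      fix j t x assume a: "j < k" "t < b" "x < b" "set_decode t \<subseteq> column k (set_decode v) j"
      then have "(j, t, x) \<in> A" unfolding A_def by blast
      then have "set_decode (r j t x) \<subseteq> set_decode u" unfolding u by blast
      with r[of j t x] a show "\<exists>r. T (r ## t ## j ## n ## x ## c) \<and> set_decode r \<subseteq> set_decode u"
        by blast
    qed
    moreover have "set_decode u \<subseteq> Y" unfolding u A_def using r by blast
    ultimately show ?thesis unfolding meets_def by blast
  qed
  have W_anti: "W n b' v' \<subseteq> W n b v" if "b \<le> b'" "set_decode v \<subseteq> set_decode v'" for n b v b' v'
    using that unfolding W_def by (blast intro: less_le_trans)
  have good: "good E" and controls: "controls E C" and tails: "range tail \<subseteq> C" using admissible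
    unfolding admissible_def by auto
  have ceC: "ce U" if "U \<in> C" for U using controls that unfolding controls_def by blast
  \<comment> \<open>No set meets the empty family, so live columns are unconstrained.\<close>
  define D' where "D' j = (if j \<in> live then {} else D j)" for j
  have D': "ce (D' j)" if "j < k" for j using ceC dead(1)[OF that] ce_empty by (auto simp: D'_def)
  obtain P where P: "eff_open sig2 P" "\<And>e X. P e (join X E) \<longleftrightarrow>
      \<not> (Z = (\<Union>j<k. column k X j) \<and> (\<forall>j<k. \<not> meets (column k X j) (D' j)))"
    using eff_open_no_cover[of Z E k D'] Z D' by blast
  obtain N0 where "eff_open sig2 N0" "\<And>e. \<not> large (insert {u. TW (u ## e)} C) UNIV \<longleftrightarrow> N0 e E"
    using controls TW unfolding controls_def by blast
  then have N0: "eff_open sig2 N0" "\<And>n b v. \<not> large (insert (W n b v) C) UNIV \<longleftrightarrow>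
    N0 (b ## v ## n ## c) E"
    unfolding WT by auto
  \<comment> \<open>\<open>P\<close> discards the sets that are not covers of the required kind; the
    other disjunct is witnessed by a finite part \<open>v\<close> of \<open>X\<close>, which keeps
    the question open.\<close>
  define Q where "Q e F \<longleftrightarrow> P e F \<or> (\<exists>b v. (\<forall>i\<in>set_decode v. 2 * i \<in> F) \<and>
      N0 (b ## v ## e) {y. Suc (2 * y) \<in> F})" for e F
  have N1: "eff_open sig2 (\<lambda>e F. N0 e {y. Suc (2 * y) \<in> F})"
    by (intro sig2.eff_open_set_subst[OF N0(1)] rec_fun_Suc rec_fun_mult rec_fun_var rec_fun_const)
  have "eff_open sig2 Q"
    unfolding Q_def
    by (intro sig2.eff_open_disj sig2.eff_open_ex sig2.eff_open_conj sig2.eff_open_decode_subset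
      P(1) sig2.eff_open_subst[OF N1]
        rec_fun_push rec_fun_mult rec_fun_var rec_fun_const)
  have Q: "Q (n ## c) (join X E) \<longleftrightarrow> P (n ## c) (join X E) \<or>
      (\<exists>b v. set_decode v \<subseteq> X \<and> \<not> large (insert (W n b v) C) UNIV)" for n X
    by (simp only: Q_def N0(2) join_iff Collect_mem_eq subset_iff Ball_def)
  from good_dichotomy[OF good \<open>eff_open sig2 Q\<close>, of c] show ?thesis
  proof cases
    case (1 n)
    obtain X0 where X0: "\<forall>j<k. column k X0 j = S j \<inter> Z" using ex_column[of k "\<lambda>j. S j \<inter> Z"] by blast
    have "\<not> meets (column k X0 j) (D' j)" if "j < k" for j
    proof (cases "j \<in> live")
      case True
      then show ?thesis by (simp add: D'_def meets_def)
    next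
      case False
      with dead(1)[OF that] X0 that show ?thesis
        by (auto simp: D'_def dest: meets_mono[of _ _ "S j" "D j"])
    qed
    moreover have "Z = (\<Union>j<k. column k X0 j)" using S X0 by auto
    ultimately have "\<not> P (n ## c) (join X0 E)" unfolding P(2) by blast
    with 1(2)[of X0] obtain b v where v: "set_decode v \<subseteq> X0" "\<not> large (insert (W n b v) C) UNIV"
      unfolding Q by blast
    then obtain q :: nat and Y where Y: "\<And>j. j < q \<Longrightarrow> \<not> positive (insert (W n b v) C) (Y j)"
      "UNIV \<subseteq> (\<Union>j<q. Y j)"
      unfolding not_large_iff by blast
    then have "\<forall>j. \<exists>D. j < q \<longrightarrow> D \<in> insert (W n b v) C \<and> \<not> meets (Y j) D" unfolding positive_def
      by blast
    then obtain D2 where D2: "\<And>j. j < q \<Longrightarrow> D2 j \<in> insert (W n b v) C"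
      "\<And>j. j < q \<Longrightarrow> \<not> meets (Y j) (D2 j)" by metis
    have "ce (W n b v)" unfolding WT by (rule ceI[OF TW])
    then have ce2: "ce (D2 j)" if "j < q" for j using D2(1)[OF that] by (auto intro: ceC)
    have cov: "Z = (\<Union>j<q. Y j \<inter> Z)" using Y(2) by blast
    have fail: "\<not> meets (Y j \<inter> Z) (D2 j)" if "j < q" for j
      using D2(2)[OF that] meets_mono by blast
    obtain X where X: "good (join X E)" "Z = (\<Union>j<q. column q X j)" "\<And>j. j < q \<Longrightarrow>
      \<not> meets (column q X j) (D2 j)"
      using good_cover[of E Z q D2 "\<lambda>j. Y j \<inter> Z", OF good Z ce2 cov fail] by blast
    obtain E' C' j where E': "admissible E' C'" "reducible E E'" "C \<subseteq> C'" "j < q"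
      "robust E' C' (column q X j)" "reducible (column q X j) E'"
      using split_cover[OF admissible robust X(1,2)] by blast
    \<comment> \<open>The robust part meets every family of \<open>C\<close>, so the family it
      misses is \<open>W n b v\<close>, and then it misses one \<open>V j' t n x\<close>. The index
      \<open>j'\<close> is live, because every set meets the families of dead columns.\<close>
    have "positive C' (column q X j)" using robust_large[OF E'(5,1)] large_imp_positive by blast
    then have "D2 j \<notin> C" using X(3)[OF E'(4)] E'(3) unfolding positive_def by blast
    with D2(1)[OF E'(4)] X(3)[OF E'(4)] have "\<not> meets (column q X j) (W n b v)" by auto
    then obtain j' t x where t: "j' < k" "set_decode t \<subseteq> column k (set_decode v) j'"
      "\<not> meets (column q X j) (V j' t n x)" using meets_W by blast
    have live': "j' \<in> live" using t(1,3) dead(2) by blast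
    have "column k (set_decode v) j' \<subseteq> column k X0 j'" using v(1) unfolding column_def by blast
    then have t': "set_decode t \<subseteq> S j' \<inter> Z" using t(2) X0 t(1) by auto
    have sub: "column q X j \<subseteq> Z" using X(2) E'(4) by blast
    show ?thesis
      by (rule exI[of _ E'], rule exI[of _ C'], rule exI[of _ "column q X j"], rule exI[of _ n],
          rule bexI[OF _ live'], intro conjI disjI1 exI[of _ t] exI[of _ x])
        (fact E'(1-3) sub E'(6,5) 1(1) t' t(3))+
  next
    case (2 n X)
    then have "\<not> P (n ## c) (join X E)" and lrg: "\<And>b v. set_decode v \<subseteq> X \<Longrightarrow>
      large (insert (W n b v) C) UNIV"
      unfolding Q by auto
    then have X: "Z = (\<Union>j<k. column k X j)" "\<And>j. j < k \<Longrightarrow> \<not> meets (column k X j) (D' j)"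
      unfolding P(2) by auto
    define C1 where "C1 = C \<union> {W n b v | b v. set_decode v \<subseteq> X}"
    have "controls (join X E) C1" "large C1 UNIV"
      using directed_controls[OF controls reducible_join(2) reducible_join(1) TW WT W_anti lrg]
        unfolding C1_def by blast+
    then have 1: "admissible (join X E) C1" unfolding admissible_def using 2(3) tails
      by (auto simp: C1_def)
    have "robust (join X E) C1 Z" using robust_ext[OF robust reducible_join(2)]
      by (auto simp: C1_def)
    then obtain E' C' j where E': "admissible E' C'" "reducible (join X E) E'" "C1 \<subseteq> C'" "j < k"
      "robust E' C' (column k X j)"
      using robust_split[OF 1, of Z "column k X" k] X(1) by blast
    have CC': "C \<subseteq> C'" using E'(3) by (auto simp: C1_def)
    \<comment> \<open>A dead column misses a family of \<open>C\<close>, so the robust column is a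
      live one.\<close>
    have "positive C' (column k X j)" using robust_large[OF E'(5,1)] large_imp_positive by blast
    with X(2)[OF E'(4)] dead(1)[OF E'(4)] CC' have live': "j \<in> live"
      unfolding D'_def positive_def by (auto split: if_splits)
    have V': "meets Y (V j t n x)" if t: "set_decode t \<subseteq> column k X j" and Y: "positive C' Y"
      for t x Y
    proof -
      \<comment> \<open>The finite part of \<open>X\<close> that places \<open>t\<close> in column
        \<open>j\<close>. Below, the bound \<open>Suc (max t x)\<close> is chosen to exceed
        \<open>t\<close> and \<open>x\<close>.\<close>
      define v where "v = set_encode {k * i + j | i. i \<in> set_decode t}"
      have v: "set_decode v = {k * i + j | i. i \<in> set_decode t}"
        unfolding v_def by (intro set_encode_inverse) simp
      have "set_decode v \<subseteq> X" unfolding v using t by (auto simp: column_def)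
      then have "meets Y (W n (Suc (max t x)) v)" using Y E'(3) unfolding C1_def positive_def
        by blast
      then show ?thesis by (rule meets_V) (use E'(4) v in \<open>auto simp: column_def\<close>)
    qed
    have r: "reducible E E'" "reducible (column k X j) E'"
      using reducible_trans[OF reducible_join(2) E'(2)] reducible_trans[OF reducible_column E'(2)]
        by blast+
    have sub: "column k X j \<subseteq> Z" using X(1) E'(4) by blast
    show ?thesis
      by (rule exI[of _ E'], rule exI[of _ C'], rule exI[of _ "column k X j"], rule exI[of _ n],
          rule bexI[OF _ live'], intro conjI disjI2 allI impI)
        ((fact E'(1) r(1) CC' sub r(2) E'(5) 2(1))+, rule V')
  qed
qed

end

section \<open>The generic construction\<close>

lemma generic_chain:
  assumes "countable \<D>" and "p0 \<in> P"
    and refl: "\<And>p. extends p p" and trans: "\<And>p q s. extends p q \<Longrightarrow> extends q s \<Longrightarrow> extends p s"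
    and dense: "\<And>D p. D \<in> \<D> \<Longrightarrow> p \<in> P \<Longrightarrow> \<exists>q\<in>P. extends q p \<and> q \<in> D"
  shows "\<exists>G. (\<forall>s. G s \<in> P) \<and> (\<forall>s t. s \<le> t \<longrightarrow> extends (G t) (G s)) \<and> (\<forall>D\<in>\<D>. \<exists>s::nat. G s \<in> D)"
proof (cases "\<D> = {}")
  case True
  with assms(2) refl show ?thesis by (intro exI[of _ "\<lambda>_. p0"]) auto
next
  case False
  have "\<exists>G. \<forall>s. G s \<in> P \<and> (extends (G (Suc s)) (G s) \<and> G (Suc s) \<in> from_nat_into \<D> s)"
  proof (rule dependent_nat_choice)
    show "\<exists>p. p \<in> P" using assms(2) by blast
    fix p and s :: nat assume "p \<in> P"
    with dense[OF from_nat_into[OF False]]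
    show "\<exists>q. q \<in> P \<and> extends q p \<and> q \<in> from_nat_into \<D> s" by blast
  qed
  then obtain G where G: "\<And>s. G s \<in> P" "\<And>s. extends (G (Suc s)) (G s)"
    "\<And>s. G (Suc s) \<in> from_nat_into \<D> s"
    by blast
  have "extends (G t) (G s)" if "s \<le> t" for s t
    using that by (induction rule: dec_induct) (use refl trans G(2) in blast)+
  moreover have "\<exists>s. G s \<in> D" if "D \<in> \<D>" for D
    using from_nat_into_surj[OF assms(1) that] G(3) by metis
  ultimately show ?thesis using G(1) by blast
qed

text \<open>If \<open>q\<close> decides the matrix of a \<open>\<Sigma>\<^sub>2\<close> definition
  relative to \<open>H\<close>, this says that \<open>x\<close> is no witness for
  \<open>n\<close>.\<close>

definition diverts :: "recf \<Rightarrow> nat set \<Rightarrow> nat \<Rightarrow> nat \<Rightarrow> bool" where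
  "diverts q H n x \<longleftrightarrow> (\<exists>y. eval H q [n, x, y] 0)"

lemma sig1_diverts:
  assumes "rec_fun h" "rec_fun n" "rec_fun x"
  shows "sig1 (\<lambda>e. diverts q (set_decode (h e)) (n e) (x e))"
proof -
  have m: "[a, b, c] = map (a ## b ## c ## (\<lambda>_. 0)) [0..<Suc (Suc (Suc 0))]" for a b c :: nat
    by (simp only: map_push) simp
  show ?thesis
    unfolding diverts_def m
    by (intro sig1.ex sig1_eval rec_fun_push rec_fun_var rec_fun_const assms[THEN rec_fun_subst])
qed

text \<open>The sides share one reservoir but have separate stems. Membership below
  \<open>bound\<close> is final, which turns agreement with a stem into a finite condition on the
  generic sets.\<close>

datatype condition = Condition (oracle_of: "nat set") (families: "nat set set") (reservoir:
"nat set")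
  (stem: "nat \<Rightarrow> nat set") (bound: nat)

context not_Sigma2 begin

definition state :: "nat set \<Rightarrow> nat set set \<Rightarrow> nat set \<Rightarrow> bool" where
  "state E C Z \<longleftrightarrow> admissible E C \<and> reducible Z E \<and> robust E C Z"

text \<open>The reservoir \<open>UNIV\<close> is not many-one reducible to the empty oracle, so the
  first oracle is \<open>join UNIV {}\<close>. It is good by the basis theorem for the class whose
  only member is \<open>UNIV\<close>.\<close>

lemma ex_state: "\<exists>E C Z. state E C Z"
proof -
  have "eff_open sig2 (\<lambda>e F. \<exists>i. 2 * i \<notin> F)"
    by (intro sig2.eff_open_ex sig2.eff_open_nmem rec_fun_mult rec_fun_const rec_fun_var)
  then have "\<exists>X. \<not> (\<exists>i. 2 * i \<notin> join X {}) \<and> good (join X {})"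
    by (rule good_basis[OF good_empty, of _ "\<lambda>_. 0" UNIV]) simp
  then obtain X where X: "\<forall>i. i \<in> X" "good (join X {})" by auto
  moreover from X(1) have "X = UNIV" by blast
  ultimately have "good (join UNIV {})" by simp
  then have "admissible (join UNIV {}) (range tail)"
    unfolding admissible_def using controls_tails large_tails by blast
  moreover have "robust E C UNIV" for E C unfolding robust_def admissible_def by blast
  ultimately show ?thesis unfolding state_def using reducible_join(1) by blast
qed

end

text \<open>
  Minimality of \<open>I\<close> ensures that the sides in \<open>I\<close> remain large below \<open>(E0, C0, Z0)\<close>, while the
  union of the other sides is already small there.
\<close>

locale partition_forcing = not_Sigma2 +
  fixes A :: "nat \<Rightarrow> nat set" and r :: nat and I :: "nat set"
    and E0 :: "nat set" and C0 :: "nat set set" and Z0 :: "nat set"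
  assumes I: "I \<subseteq> {..<r}"
    and state0: "state E0 C0 Z0"
    and small: "\<not> large C0 (Z0 - (\<Union>i\<in>I. A i))"
    and minimal: "\<And>J E C Z. J \<subset> I \<Longrightarrow> state E C Z \<Longrightarrow> large C (Z - (\<Union>i\<in>J. A i))"
begin

definition conds :: "condition set" where
  "conds = {p. state (oracle_of p) (families p) (reservoir p) \<and> C0 \<subseteq> families p \<and> reservoir p \<subseteq> Z0 \<and>
     (\<forall>i\<in>I. stem p i \<subseteq> A i \<inter> {..<bound p})}"

definition extends :: "condition \<Rightarrow> condition \<Rightarrow> bool" where
  "extends q p \<longleftrightarrow> reducible (oracle_of p) (oracle_of q) \<and> families p \<subseteq> families q \<and>
  reservoir q \<subseteq> reservoir p \<and> bound p \<le> bound q \<and>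
     (\<forall>i\<in>I. stem p i \<subseteq> stem q i \<and> stem q i \<subseteq> stem p i \<union> (reservoir p \<inter> {bound p..}))"

lemma extends_refl: "extends p p"
  unfolding extends_def using reducible_refl by blast

lemma extends_trans: "extends s q" if "extends s p" "extends p q"
proof -
  have "stem s i \<subseteq> stem q i \<union> (reservoir q \<inter> {bound q..})" if i: "i \<in> I" for i
  proof -
    have "stem s i \<subseteq> stem p i \<union> (reservoir p \<inter> {bound p..})"
      "stem p i \<subseteq> stem q i \<union> (reservoir q \<inter> {bound q..})"
      "reservoir p \<subseteq> reservoir q" "bound q \<le> bound p" using \<open>extends s p\<close> \<open>extends p q\<close> i
      unfolding extends_def by auto
    then show ?thesis by fastforce
  qed
  with that show ?thesis unfolding extends_def using reducible_trans by (meson order_trans)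
qed

lemma condD:
  assumes "p \<in> conds"
  shows "admissible (oracle_of p) (families p)" "reducible (reservoir p) (oracle_of p)"
    "robust (oracle_of p) (families p) (reservoir p)"
    "range tail \<subseteq> families p" "C0 \<subseteq> families p" "reservoir p \<subseteq> Z0" "\<And>i. i \<in> I \<Longrightarrow> stem p i \<subseteq> A i"
    "\<And>i. i \<in> I \<Longrightarrow> stem p i \<subseteq> {..<bound p}"
  using assms unfolding conds_def state_def admissible_def by auto

lemma not_large_res: "p \<in> conds \<Longrightarrow> \<not> large (families p) (reservoir p - (\<Union>i\<in>I. A i))"
  using small large_antimono[of "families p" "reservoir p - (\<Union>i\<in>I. A i)"
    "Z0 - (\<Union>i\<in>I. A i)" C0] condD(5,6)
  by blast

text \<open>By minimality the reservoir stays large without the sides other than \<open>i\<close>.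
  What is then left splits into a piece outside all sides of \<open>I\<close>, which is small, and
  the piece inside \<open>A i\<close>.\<close>

lemma large_res:
  assumes p: "p \<in> conds" and "i \<in> I"
  shows "large (families p) (reservoir p \<inter> A i \<inter> {m..})"
proof -
  have "large (families p) (reservoir p - (\<Union>j\<in>I - {i}. A j))"
    using p assms(2) by (intro minimal[of _ "oracle_of p"]) (auto simp: conds_def)
  then have "large (families p) ((reservoir p - (\<Union>j\<in>I. A j)) \<union> (reservoir p \<inter> A i))"
    by (rule large_antimono) auto
  then have "large (families p) (reservoir p - (\<Union>j\<in>I. A j)) \<or>
    large (families p) (reservoir p \<inter> A i)"
    by (rule large_Un)
  with not_large_res[OF p] condD(4)[OF p] show ?thesis using large_inter_atLeast by blast
qed

lemma extend_stem:
  assumes p: "p \<in> conds" and i: "i \<in> I" and R: "R \<subseteq> reservoir p \<inter> A i \<inter> {bound p..}"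
    and m: "R \<subseteq> {..<m}" "bound p \<le> m"
    and E: "admissible E C" "reducible (oracle_of p) E" "families p \<subseteq> C" "Z \<subseteq> reservoir p"
      "reducible Z E" "robust E C Z"
  defines "q \<equiv> Condition E C Z ((stem p)(i := stem p i \<union> R)) m"
  shows "q \<in> conds" "extends q p"
proof -
  show "q \<in> conds"
    unfolding conds_def state_def
  proof (intro CollectI conjI ballI)
    fix j assume "j \<in> I"
    then have "stem p j \<subseteq> A j" "stem p j \<subseteq> {..<bound p}" using condD(7,8)[OF p] by auto
    with m R show "stem q j \<subseteq> A j \<inter> {..<bound q}" by (auto simp: q_def)
  qed (use E condD(5,6)[OF p] in \<open>auto simp: q_def\<close>)
  show "extends q p"
    using E R m unfolding q_def extends_def by auto
qed

lemma dense_unbounded: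
  assumes p: "p \<in> conds"
  shows "\<exists>q\<in>conds. extends q p \<and> (i \<in> I \<longrightarrow> (\<exists>a\<in>stem q i. N \<le> a))"
proof (cases "i \<in> I")
  case True
  have "positive (families p) (reservoir p \<inter> A i \<inter> {max N (bound p)..})"
    by (intro large_imp_positive large_res[OF p True])
  then have "reservoir p \<inter> A i \<inter> {max N (bound p)..} \<noteq> {}"
    using positive_tails_infinite[OF condD(4)[OF p]] infinite_imp_nonempty by blast
  then obtain a where "a \<in> reservoir p \<inter> A i \<inter> {max N (bound p)..}" by blast
  then have a: "a \<in> reservoir p \<inter> A i" "N \<le> a" "bound p \<le> a" by auto
  let ?q = "Condition (oracle_of p) (families p) (reservoir p) ((stem p)(i :=
  stem p i \<union> {a})) (Suc a)"
  have "?q \<in> conds" "extends ?q p"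
    using a condD[OF p] reducible_refl by (intro extend_stem[OF p True]; simp)+
  with a show ?thesis by (intro bexI[of _ ?q]) auto
qed (use p extends_refl in blast)

text \<open>
  The first case forces some \<open>n \<notin> B\<close> into the set defined by \<open>q\<close>; in the second case, \<open>n \<in> B\<close>
  stays out because every \<open>x\<close> can be refuted from every later condition.
\<close>

definition refutes :: "condition \<Rightarrow> nat \<Rightarrow> recf \<Rightarrow> bool" where
  "refutes p i q \<longleftrightarrow>
    (\<exists>n x. n \<notin> B \<and> (\<forall>R \<subseteq> reservoir p. finite R \<longrightarrow> \<not> diverts q (stem p i \<union> R) n x)) \<or>
    (\<exists>n\<in>B. \<forall>x T Y. finite T \<longrightarrow> T \<subseteq> reservoir p \<longrightarrow> positive (families p) Y \<longrightarrow>
       (\<exists>R. finite R \<and> R \<subseteq> Y \<and> diverts q (stem p i \<union> T \<union> R) n x))"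

text \<open>Only a disjunction over the sides can be achieved, since \<open>extension\<close> itself
  chooses the live column that it serves.\<close>

lemma dense_refutes:
  assumes p: "p \<in> conds"
  shows "\<exists>q\<in>conds. extends q p \<and> (\<exists>i\<in>I. refutes q i (Q i))"
proof -
  let ?m = "bound p"
  \<comment> \<open>The numbers below the bound that are added to the remainder are finitely many
    and cannot make it large.\<close>
  have "\<not> large (families p) (reservoir p - (\<Union>i\<in>I. A i \<inter> {?m..}))"
  proof
    assume "large (families p) (reservoir p - (\<Union>i\<in>I. A i \<inter> {?m..}))"
    then have "large (families p) ((reservoir p - (\<Union>i\<in>I. A i \<inter> {?m..})) \<inter> {?m..})"
      by (rule large_inter_atLeast[OF condD(4)[OF p]])
    then have "large (families p) (reservoir p - (\<Union>i\<in>I. A i))" by (rule large_antimono) auto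
    with not_large_res[OF p] show False by blast
  qed
  then obtain k0 :: nat and Y where Y: "\<And>l. l < k0 \<Longrightarrow> \<not> positive (families p) (Y l)"
    "reservoir p - (\<Union>i\<in>I. A i \<inter> {?m..}) \<subseteq> (\<Union>l<k0. Y l)" unfolding not_large_iff by blast
  have "\<forall>l. \<exists>D. l < k0 \<longrightarrow> D \<in> families p \<and> \<not> meets (Y l) D" using Y(1) unfolding positive_def
    by blast
  then obtain D0 where D0: "\<And>l. l < k0 \<Longrightarrow> D0 l \<in> families p \<and> \<not> meets (Y l) (D0 l)" by metis
  \<comment> \<open>The first \<open>r\<close> columns are for the sides, the other
    \<open>k0\<close> for the parts of the small remainder. A side outside \<open>I\<close> is
    replaced by the empty set, which misses \<open>tail 0\<close>.\<close>
  define k where "k = r + k0"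
  define S where "S j = (if j < r then if j \<in> I then A j \<inter> {?m..} else {} else Y (j - r))" for j
  define D where "D j = (if j < r then tail 0 else D0 (j - r))" for j
  have I_less: "j < r" "j < k" if "j \<in> I" for j using that I by (auto simp: k_def)
  have fin: "finite (stem p j)" if "j \<in> I" for j
    using condD(8)[OF p that] finite_subset by blast
  \<comment> \<open>The arguments are the new part \<open>u\<close>, the part \<open>t\<close>, then
    \<open>n\<close> and \<open>x\<close>. The value \<open>True\<close> outside \<open>I\<close>
    makes every set meet the families of dead columns, through the code 0.\<close>
  define U where "U j e \<longleftrightarrow> (if j \<in> I then
      diverts (Q j) (stem p j \<union> set_decode (e 1) \<union> set_decode (e 0)) (e 2) (e 3) else True)"
    for j and e :: "nat \<Rightarrow> nat"
  have "sig1 (U j)" for j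
  proof (cases "j \<in> I")
    case True
    define f where "f = set_encode (stem p j)"
    have f: "set_decode f = stem p j" unfolding f_def using fin[OF True] by simp
    \<comment> \<open>The oracle has to be a code \<open>h\<close>. That \<open>h\<close> codes the
      union is a bounded check, since members of a coded set are smaller than its code.\<close>
    have "sig1 (\<lambda>e. \<exists>h. (set_decode f \<subseteq> set_decode h \<and> set_decode (e 1) \<subseteq> set_decode h \<and>
        set_decode (e 0) \<subseteq> set_decode h \<and>
        (\<forall>i<h. i \<notin> set_decode h \<or> i \<in> set_decode f \<or> i \<in> set_decode (e 1) \<or> i \<in> set_decode (e 0))) \<and>
        diverts (Q j) (set_decode h) (e 2) (e 3))"
      by (intro sig1.ex sig1.conj sig1.rec_rel rec_rel_conj rec_rel_decode_subset rec_rel_ball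
        rec_rel_disj rec_rel_not rec_rel_decode
          sig1_diverts rec_fun_var rec_fun_const)
    moreover have "(\<exists>h. (set_decode f \<subseteq> set_decode h \<and> set_decode t \<subseteq> set_decode h \<and>
        set_decode u \<subseteq> set_decode h \<and>
        (\<forall>i<h. i \<notin> set_decode h \<or> i \<in> set_decode f \<or> i \<in> set_decode t \<or> i \<in> set_decode u)) \<and>
        diverts (Q j) (set_decode h) n x) \<longleftrightarrow>
        diverts (Q j) (stem p j \<union> set_decode t \<union> set_decode u) n x" (is "(\<exists>h. ?eq h \<and> _ h) \<longleftrightarrow> _")
      for t u n x
    proof -
      have eq: "?eq h \<longleftrightarrow> set_decode h = stem p j \<union> set_decode t \<union> set_decode u" for h
        unfolding f using mem_decode_less by blast
      have ex: "set_decode (set_encode (stem p j \<union> set_decode t \<union> set_decode u)) =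
          stem p j \<union> set_decode t \<union> set_decode u"
        by (intro set_encode_inverse finite_UnI fin[OF True] finite_set_decode)
      show ?thesis unfolding eq by (metis ex)
    qed
    ultimately show ?thesis using True by (simp add: U_def[abs_def])
  qed (simp add: U_def[abs_def] sig1.rec_rel rec_rel_const)
  then obtain Q' where Q': "sig1 Q'" "\<And>j e. j < k \<Longrightarrow> Q' (j ## e) \<longleftrightarrow> U j e"
    using finite_case_sig1[of k U] by blast
  define T where "T e \<longleftrightarrow> Q' (e 2 ## e 0 ## e 1 ## e 3 ## e 4 ## (\<lambda>_. 0))" for e :: "nat \<Rightarrow> nat"
  have T: "sig1 T"
    unfolding T_def by (intro sig1.subst[OF Q'(1)] rec_fun_push rec_fun_var rec_fun_const)
  define V where "V j t n x = {u. T (u ## t ## j ## n ## x ## (\<lambda>_. 0))}" for j t n x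
  have V_iff: "V j t n x = {u. U j (u ## t ## n ## x ## (\<lambda>_. 0))}" if "j < k" for j t n x
    unfolding V_def T_def using Q'(2)[OF that] by (simp add: eval_nat_numeral)
  have V_live: "meets X (V j t n x) \<longleftrightarrow>
      (\<exists>R. finite R \<and> R \<subseteq> X \<and> diverts (Q j) (stem p j \<union> set_decode t \<union> R) n x)" if "j \<in> I"
      for X j t n x
  proof -
    have "meets X (V j t n x) \<longleftrightarrow>
        (\<exists>u. set_decode u \<subseteq> X \<and> diverts (Q j) (stem p j \<union> set_decode t \<union> set_decode u) n x)"
      unfolding meets_def V_iff[OF I_less(2)[OF that]] U_def using that
      by (auto simp: eval_nat_numeral)
    then show ?thesis using finite_set_decode set_encode_inverse by metis
  qed
  have "\<exists>E' C' Z' n. \<exists>j\<in>I. admissible E' C' \<and> reducible (oracle_of p) E' \<and> families p \<subseteq> C' \<and>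
    Z' \<subseteq> reservoir p \<and> reducible Z' E' \<and> robust E' C' Z' \<and>
    ((n \<notin> B \<and> (\<exists>t x. set_decode t \<subseteq> S j \<inter> reservoir p \<and> \<not> meets Z' (V j t n x))) \<or>
     (n \<in> B \<and> (\<forall>t x Y. set_decode t \<subseteq> Z' \<longrightarrow> positive C' Y \<longrightarrow> meets Y (V j t n x))))"
  proof (rule extension[OF condD(1,3,2)[OF p] T V_def, where k = k and D = D])
    show "I \<subseteq> {..<k}" using I_less by blast
    show "D j \<in> families p \<and> \<not> meets (S j) (D j)" if "j < k" "j \<notin> I" for j
      using that D0[of "j - r"] condD(4)[OF p] unfolding D_def S_def k_def
      by (auto simp: meets_tail)
    show "meets X (V j t n x)" if "j < k" "j \<notin> I" for j t n x X
      using that unfolding meets_def V_iff[OF that(1)] U_def by (intro bexI[of _ 0]) auto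
    show "reservoir p \<subseteq> (\<Union>j<k. S j)"
    proof
      fix a assume a: "a \<in> reservoir p"
      show "a \<in> (\<Union>j<k. S j)"
      proof (cases "a \<in> (\<Union>i\<in>I. A i \<inter> {?m..})")
        case True
        then obtain i where "i \<in> I" "a \<in> A i \<inter> {?m..}" by blast
        then have "a \<in> S i" "i < k" using I_less by (auto simp: S_def)
        then show ?thesis by blast
      next
        case False
        with a Y(2) obtain l where "l < k0" "a \<in> Y l" by blast
        then have "a \<in> S (r + l)" "r + l < k" by (auto simp: S_def k_def)
        then show ?thesis by blast
      qed
    qed
  qed
  then obtain E' C' Z' n j where j: "j \<in> I" and ext: "admissible E' C'"
    "reducible (oracle_of p) E'" "families p \<subseteq> C'"
      "Z' \<subseteq> reservoir p" "reducible Z' E'" "robust E' C' Z'"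
    and "(n \<notin> B \<and> (\<exists>t x. set_decode t \<subseteq> S j \<inter> reservoir p \<and> \<not> meets Z' (V j t n x))) \<or>
     (n \<in> B \<and> (\<forall>t x Y. set_decode t \<subseteq> Z' \<longrightarrow> positive C' Y \<longrightarrow> meets Y (V j t n x)))" by blast
  from this(8) show ?thesis
  proof (elim disjE conjE exE)
    fix t x assume n: "n \<notin> B" and t: "set_decode t \<subseteq> S j \<inter> reservoir p" "\<not> meets Z' (V j t n x)"
    \<comment> \<open>The new bound is large enough because members of \<open>set_decode t\<close>
      are below \<open>t\<close>.\<close>
    let ?q = "Condition E' C' Z' ((stem p)(j := stem p j \<union> set_decode t)) (?m + t)"
    have "set_decode t \<subseteq> {..<?m + t}" using mem_decode_less by (auto intro: trans_less_add2)
    moreover have "set_decode t \<subseteq> reservoir p \<inter> A j \<inter> {?m..}"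
      using t(1) I_less(1)[OF j] j by (auto simp: S_def)
    ultimately have "?q \<in> conds" "extends ?q p" using extend_stem[OF p j] ext by simp_all
    moreover have "refutes ?q j (Q j)"
      using n t(2) unfolding refutes_def V_live[OF j] by auto
    ultimately show ?thesis using j by blast
  next
    assume n: "n \<in> B" and V: "\<forall>t x Y. set_decode t \<subseteq> Z' \<longrightarrow> positive C' Y \<longrightarrow> meets Y (V j t n x)"
    let ?q = "Condition E' C' Z' ((stem p)(j := stem p j \<union> {})) ?m"
    have "?q \<in> conds" "extends ?q p" using extend_stem[OF p j _ _ _ ext, of "{}" ?m] by simp_all
    moreover have "refutes ?q j (Q j)"
    proof -
      have "\<exists>R. finite R \<and> R \<subseteq> X \<and> diverts (Q j) (stem p j \<union> T \<union> R) n x"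
        if "finite T" "T \<subseteq> Z'" "positive C' X" for T X x
        using V[rule_format, of "set_encode T" X x] that unfolding V_live[OF j] by simp
      then show ?thesis
        unfolding refutes_def by (intro disjI2 bexI[OF _ n] allI impI) simp
    qed
    ultimately show ?thesis using j by blast
  qed
qed

section \<open>Deciding refutations, and the generic sets\<close>

definition forces :: "condition \<Rightarrow> nat \<Rightarrow> recf \<Rightarrow> nat \<Rightarrow> nat \<Rightarrow> bool" where
  "forces p i q n x \<longleftrightarrow> (\<forall>H. agree (bound p) (stem p i) H \<longrightarrow> diverts q H n x)"

text \<open>In the second case of \<open>refutes\<close> a refutation of \<open>x\<close> can be
  added at every later stage, but nothing says that it ever is. Deciding closes this gap: a
  refutation that remains possible has then already been forced.\<close>

definition decides :: "condition \<Rightarrow> nat \<Rightarrow> recf \<Rightarrow> nat \<Rightarrow> nat \<Rightarrow> bool" where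
  "decides p i q n x \<longleftrightarrow> forces p i q n x \<or> (\<forall>p'\<in>conds. extends p' p \<longrightarrow> \<not> forces p' i q n x)"

lemma dense_decides:
  assumes "p \<in> conds"
  shows "\<exists>p'\<in>conds. extends p' p \<and> decides p' i q n x"
  using assms extends_refl unfolding decides_def by blast

lemma diverts_use: "diverts q H n x \<Longrightarrow> \<exists>m. \<forall>H'. agree m H H' \<longrightarrow> diverts q H' n x"
  unfolding diverts_def using eval_use by blast

lemma ex_generic:
  "\<exists>i\<in>I. \<exists>H. infinite H \<and> H \<subseteq> A i \<and> \<not> Sigma2_in H B"
proof -
  \<comment> \<open>Tuples of programs are lists, which keeps the requirements countable.\<close>
  define \<D> where "\<D> = range (\<lambda>(i, N). {p. i \<in> I \<longrightarrow> (\<exists>a\<in>stem p i. N \<le> a)}) \<union>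
    range (\<lambda>Q. {p. \<exists>i\<in>I. refutes p i (Q ! i)}) \<union>
    range (\<lambda>(i, q, n, x). {p. decides p i q n x})"
  have "\<exists>G. (\<forall>s. G s \<in> conds) \<and> (\<forall>s t. s \<le> t \<longrightarrow> extends (G t) (G s)) \<and> (\<forall>D\<in>\<D>. \<exists>s::nat. G s \<in> D)"
  proof (rule generic_chain[OF _ _ extends_refl extends_trans])
    show "countable \<D>" unfolding \<D>_def by simp
    show "Condition E0 C0 Z0 (\<lambda>_. {}) 0 \<in> conds"
      using state0 unfolding conds_def by simp
    show "\<exists>q\<in>conds. extends q p \<and> q \<in> D" if "D \<in> \<D>" "p \<in> conds" for D p
      using that dense_unbounded dense_refutes dense_decides unfolding \<D>_def by fastforce
  qed
  then obtain G where *: "\<forall>s. G s \<in> conds" "\<forall>s t. s \<le> t \<longrightarrow> extends (G t) (G s)"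
    "\<forall>D\<in>\<D>. \<exists>s::nat. G s \<in> D" by (elim exE conjE)
  note G = *[rule_format]
  define H where "H i = (\<Union>s. stem (G s) i)" for i
  have mono: "stem (G s) i \<subseteq> stem (G t) i" "stem (G t) i \<subseteq> stem (G s) i \<union> (reservoir (G s) \<inter>
    {bound (G s)..})"
    if "i \<in> I" "s \<le> t" for i s t using G(2)[OF that(2)] that(1) unfolding extends_def by auto
  have H_A: "H i \<subseteq> A i" if "i \<in> I" for i using condD(7)[OF G(1) that] unfolding H_def by blast
  have H_inf: "infinite (H i)" if i: "i \<in> I" for i
  proof -
    have "\<exists>a\<ge>N. a \<in> H i" for N
    proof -
      have "{p. i \<in> I \<longrightarrow> (\<exists>a\<in>stem p i. N \<le> a)} \<in> \<D>" unfolding \<D>_def by auto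
      from G(3)[OF this] i show ?thesis unfolding H_def by auto
    qed
    then show ?thesis unfolding infinite_nat_iff_unbounded_le by blast
  qed
  have agree_late: "agree (bound (G s)) (stem (G s) i) (H i)" if i: "i \<in> I" for i s
    unfolding agree_def
  proof (intro allI impI)
    fix a assume a: "a < bound (G s)"
    have "a \<in> stem (G s) i" if "a \<in> stem (G t) i" for t
    proof (cases "s \<le> t")
      case True
      with mono(2)[OF i True] that a show ?thesis by auto
    next
      case False
      with mono(1)[OF i, of t s] that show ?thesis by auto
    qed
    then show "a \<in> stem (G s) i \<longleftrightarrow> a \<in> H i" unfolding H_def by blast
  qed
  have limit: "\<exists>t\<ge>s. agree m (H i) (stem (G t) i)" if i: "i \<in> I" for i m s
  proof -
    have "\<forall>a. \<exists>t. a \<in> H i \<longrightarrow> a \<in> stem (G t) i" unfolding H_def by blast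
    then obtain f where f: "\<And>a. a \<in> H i \<Longrightarrow> a \<in> stem (G (f a)) i" by metis
    define t where "t = s + (\<Sum>a<m. f a)"
    have "a \<in> stem (G t) i" if "a < m" "a \<in> H i" for a
    proof -
      have "f a \<le> (\<Sum>a<m. f a)" using that by (intro member_le_sum) auto
      then have "f a \<le> t" by (simp add: t_def)
      with f[OF that(2)] mono(1)[OF i] show ?thesis by blast
    qed
    then have "agree m (H i) (stem (G t) i)" unfolding agree_def H_def by blast
    then show ?thesis by (intro exI[of _ t]) (simp add: t_def)
  qed
  show ?thesis
  proof (rule ccontr)
    assume "\<not> ?thesis"
    \<comment> \<open>Each side would have a program defining \<open>B\<close> from its own set;
      together these programs form one tuple of the requirements.\<close>
    then have "\<forall>i. \<exists>q R. i \<in> I \<longrightarrow> (\<forall>n x y. eval (H i) q [n, x, y] (if R n x y then 1 else 0)) \<and>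
        B = {n. \<exists>x. \<forall>y. R n x y}"
      using H_A H_inf unfolding Sigma2_in_def computable_rel3_in_def by metis
    then obtain q R where q: "\<And>i n x y. i \<in> I \<Longrightarrow> eval (H i) (q i) [n, x, y] (if R i n x y then 1
      else 0)"
      and B: "\<And>i. i \<in> I \<Longrightarrow> B = {n. \<exists>x. \<forall>y. R i n x y}" by metis
    have "eval (H i) (q i) [n, x, y] 0 \<longleftrightarrow> \<not> R i n x y" if "i \<in> I" for i n x y
      using q[OF that, of n x y] eval_deterministic[OF q[OF that, of n x y], of 0]
        by (auto split: if_splits)
    then have B_iff: "n \<in> B \<longleftrightarrow> (\<exists>x. \<not> diverts (q i) (H i) n x)" if "i \<in> I" for i n
      unfolding diverts_def using B[OF that] that by blast
    have "{p. \<exists>i\<in>I. refutes p i (map q [0..<r] ! i)} \<in> \<D>" unfolding \<D>_def by blast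
    from G(3)[OF this] obtain s i where i: "i \<in> I" and "refutes (G s) i (map q [0..<r] ! i)"
      by blast
    then have "refutes (G s) i (q i)" using I by auto
    then show False
      unfolding refutes_def
    proof (elim disjE exE conjE bexE)
      fix n x assume "n \<notin> B"
        and R: "\<forall>R\<subseteq>reservoir (G s). finite R \<longrightarrow> \<not> diverts (q i) (stem (G s) i \<union> R) n x"
      then have "diverts (q i) (H i) n x" using B_iff[OF i] by blast
      \<comment> \<open>A refutation by \<open>H i\<close> has finite use, so it would already occur
        with a later stem, whose new elements come from the reservoir.\<close>
      then obtain m where m: "\<And>H'. agree m (H i) H' \<Longrightarrow> diverts (q i) H' n x" using diverts_use
        by blast
      obtain t where t: "s \<le> t" "agree m (H i) (stem (G t) i)" using limit[OF i] by blast
      let ?R = "stem (G t) i - stem (G s) i"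
      have "finite ?R" using condD(8)[OF G(1)[of t] i] finite_subset by blast
      moreover have "?R \<subseteq> reservoir (G s)" using mono(2)[OF i t(1)] by blast
      ultimately have "\<not> diverts (q i) (stem (G s) i \<union> ?R) n x" using R by blast
      moreover have "stem (G s) i \<union> ?R = stem (G t) i" using mono(1)[OF i t(1)] by blast
      ultimately show False using m[OF t(2)] by simp
    next
      fix n assume "n \<in> B" and *: "\<forall>x T Y. finite T \<longrightarrow> T \<subseteq> reservoir (G s) \<longrightarrow>
      positive (families (G s)) Y \<longrightarrow>
        (\<exists>R. finite R \<and> R \<subseteq> Y \<and> diverts (q i) (stem (G s) i \<union> T \<union> R) n x)"
      then obtain x where x: "\<not> diverts (q i) (H i) n x" using B_iff[OF i] by blast
      have "{p. decides p i (q i) n x} \<in> \<D>" unfolding \<D>_def by force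
      from G(3)[OF this] obtain t where t: "decides (G t) i (q i) n x" by blast
      define u where "u = max s t"
      define p where "p = G u"
      have p: "p \<in> conds" "extends p (G s)" "extends p (G t)" unfolding p_def u_def
        by (auto intro: G)
      \<comment> \<open>Past both stages the reservoir on side \<open>i\<close> is still large, so a
        refutation \<open>R\<close> exists inside it. Adding \<open>R\<close> to the stem forces the
        refutation, hence by the decision it was forced at \<open>G t\<close>.\<close>
      have "large (families p) (reservoir p \<inter> A i \<inter> {bound p..})" by (rule large_res[OF p(1) i])
      then have positive: "positive (families (G s)) (reservoir p \<inter> A i \<inter> {bound p..})"
        using p(2) large_imp_positive positive_mono[OF _ order_refl] unfolding extends_def by metis
      let ?T = "stem p i - stem (G s) i"
      have "finite ?T" using condD(8)[OF p(1) i] finite_subset by blast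
      moreover have "?T \<subseteq> reservoir (G s)" and T: "stem (G s) i \<union> ?T = stem p i"
        using p(2) i unfolding extends_def by blast+
      ultimately obtain R where R: "finite R" "R \<subseteq> reservoir p \<inter> A i \<inter> {bound p..}"
        "diverts (q i) (stem p i \<union> R) n x" using * positive T by metis
      obtain m where m: "\<And>H'. agree m (stem p i \<union> R) H' \<Longrightarrow> diverts (q i) H' n x"
        using diverts_use[OF R(3)] by blast
      obtain m' where m': "R \<subseteq> {..<m'}" using R(1) finite_nat_iff_bounded by blast
      \<comment> \<open>The bound must pass the use of the refutation, the elements of
        \<open>R\<close> and the old bound.\<close>
      let ?b = "m + m' + bound p"
      let ?p = "Condition (oracle_of p) (families p) (reservoir p) ((stem p)(i := stem p i \<union> R)) ?b"
      have b: "R \<subseteq> {..<?b}" using m' by (auto intro: less_le_trans)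
      have p': "?p \<in> conds" "extends ?p p"
        using extend_stem[OF p(1) i R(2) b _ condD(1)[OF p(1)] reducible_refl order_refl
          order_refl condD(2,3)[OF p(1)]]
        by simp_all
      have "forces ?p i (q i) n x"
        unfolding forces_def using m agree_mono[of ?b _ _ m] by auto
      moreover have "extends ?p (G t)" using p'(2) p(3) by (rule extends_trans)
      ultimately have "forces (G t) i (q i) n x"
        using t p'(1) unfolding decides_def by blast
      with x agree_late[OF i] show False unfolding forces_def by blast
    qed
  qed
qed

end

context not_Sigma2 begin

theorem partition_preserves_not_Sigma2:
  fixes A :: "nat \<Rightarrow> nat set"
  assumes "(\<Union>i<r. A i) = UNIV"
  shows "\<exists>i<r. \<exists>H. infinite H \<and> H \<subseteq> A i \<and> \<not> Sigma2_in H B"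
proof -
  define ok where "ok I \<longleftrightarrow> I \<subseteq> {..<r} \<and> (\<exists>E C Z. state E C Z \<and> \<not> large C (Z - (\<Union>i\<in>I. A i)))" for I
  \<comment> \<open>With all sides removed nothing of \<open>Z\<close> is left, and the empty set is
    never large. Least cardinality then yields the minimality demanded by
    \<open>partition_forcing\<close>.\<close>
  have "ok {..<r}" using ex_state assms not_large_empty unfolding ok_def by auto
  then obtain I where I: "ok I" "\<And>J. ok J \<Longrightarrow> card I \<le> card J"
    using ex_has_least_nat[of ok _ card] by blast
  then obtain E C Z where *: "I \<subseteq> {..<r}" "state E C Z" "\<not> large C (Z - (\<Union>i\<in>I. A i))"
    unfolding ok_def by blast
  have "large C' (Z' - (\<Union>i\<in>J. A i))" if J: "J \<subset> I" and "state E' C' Z'" for J E' C' Z'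
  proof (rule ccontr)
    assume "\<not> ?thesis"
    with that *(1) have "ok J" unfolding ok_def by blast
    from I(2)[OF this] psubset_card_mono[OF _ J] show False
      using finite_subset[OF *(1) finite_lessThan] by simp
  qed
  then interpret partition_forcing B A r I E C Z
    using * by unfold_locales
  show ?thesis using ex_generic *(1) by blast
qed

end

theorem theorem4p1:
  fixes B :: "nat set"
  assumes "\<not> Sigma2 B"
  shows "\<forall>A :: nat set. \<exists>H. infinite H \<and> (H \<subseteq> A \<or> H \<subseteq> UNIV - A) \<and> \<not> Sigma2_in H B"
proof
  fix A :: "nat set"
  interpret not_Sigma2 B by unfold_locales (rule assms)
  let ?A = "\<lambda>i::nat. if i = 0 then A else UNIV - A"
  have "(\<Union>i<2. ?A i) = UNIV" by (auto simp: numeral_2_eq_2 lessThan_Suc)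
  from partition_preserves_not_Sigma2[OF this] obtain i H where
    "infinite H" "H \<subseteq> ?A i" "\<not> Sigma2_in H B" by blast
  then show "\<exists>H. infinite H \<and> (H \<subseteq> A \<or> H \<subseteq> UNIV - A) \<and> \<not> Sigma2_in H B"
    by (intro exI[of _ H]) (auto split: if_splits)
qed

end
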